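(* The family $\{\mathcal{G}_{\underline k}(\tau)\}$, indexed by all multi-indices $\underline k=(k_1,\dots,k_n)\in\mathbb{Z}_{\ge0}^n$, $n\ge0$, is linearly independent over the field $\mathrm{Frac}(\mathbb{Z}[[q]])$.
   Context: For $\tau$ in the upper half-plane, $q=e^{2\pi i\tau}$, put $G_0=-1$ and for $k\ge1$, $G_{2k}(q)=-\frac{B_{2k}}{4k}+\sum_{n\ge1}\sigma_{2k-1}(n)q^n$, where $\sigma_\ell(n)=\sum_{d\mid n}d^\ell$ and $\frac{z}{e^z-1}=1-\frac z2+\sum_{n\ge1}B_{2n}\frac{z^{2n}}{(2n)!}$. For a power series $f=\sum_{n\ge0}a_nq^n$ convergent on $|q|<1$ write $f^\infty=a_0$. With the shuffle product of words $[f_1|\cdots|f_r]\,\text{ш}\,[f_{r+1}|\cdots|f_{r+s}]=\sum_\sigma[f_{\sigma^{-1}(1)}|\cdots|f_{\sigma^{-1}(r+s)}]$ (over permutations increasing on $\{1,\dots,r\}$ and on $\{r+1,\dots,r+s\}$), define $R[f_1|\cdots|f_n]=\sum_{i=0}^n(-1)^{n-i}[f_1|\cdots|f_i]\,\text{ш}\,[f_n^\infty|\cdots|f_{i+1}^\infty]$, $\int_a^b[f_1|\cdots|f_n]=\int_{a\le\tau_1\le\cdots\le\tau_n\le b}f_1(\tau_1)\cdots f_n(\tau_n)d\tau_1\cdots d\tau_n$, and $I(f_1,\dots,f_n;\tau)=(2\pi i)^n\sum_{i=0}^n\int_\tau^{i\infty}R[f_1|\cdots|f_i]\int_\tau^0[f^\infty_{i+1}|\cdots|f^\infty_n]$.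 The iterated Eisenstein integrals are $\mathcal{G}_{\underline k}(\tau)=I(G_{2k_1},\dots,G_{2k_n};\tau)$, $\mathcal{G}_\emptyset=1$. They lie in the algebra $\mathbb{Q}[\log q]((q))$, where $\log q=2\pi i\tau$, which contains $\mathrm{Frac}(\mathbb{Z}[[q]])\subset\mathbb{Q}((q))$; linear independence is meant in this algebra. *)

theory Defs
  imports
    "HOL-Analysis.Analysis"
    "HOL-Computational_Algebra.Formal_Laurent_Series"
    "HOL-Computational_Algebra.Fraction_Field"
    "HOL-Combinatorics.Permutations"
begin

section \<open>Eisenstein series\<close>

text \<open>\<open>z / (e\<^sup>z - 1) = (\<Sum>n. B\<^sub>n z\<^sup>n / n!)\<close>, so that \<open>B\<^sub>1 = - 1/2\<close>.\<close>

definition bernoulli_num :: "nat \<Rightarrow> rat" where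
  "bernoulli_num n = fact n * fps_nth (fps_X / (fps_exp 1 - 1)) n"

text \<open>\<open>eisenstein k\<close> is the \<open>q\<close>-expansion of the series of weight \<open>2 k\<close>, including the
  convention for weight 0 and the quasimodular series of weight 2.\<close>

definition eisenstein :: "nat \<Rightarrow> complex fps" where
  "eisenstein k =
     (if k = 0 then - 1
      else Abs_fps (\<lambda>n. if n = 0 then - of_rat (bernoulli_num (2 * k)) / (4 * of_nat k)
                        else (\<Sum>d | d dvd n. of_nat d ^ (2 * k - 1))))"

definition const_part :: "complex fps \<Rightarrow> complex fps" where
  "const_part f = fps_const (fps_nth f 0)"


section \<open>Words, shuffles and iterated integrals\<close>

text \<open>A linear combination of words of length \<open>n\<close> in power series is represented by the integrand
  it contributes, a function of \<open>z 0, \<dots>, z (n - 1)\<close>, which stand for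
  \<open>\<tau>\<^sub>1, \<dots>, \<tau>\<^sub>n\<close>. A word is thus the product of its letters, each in its own
  variable.\<close>

definition word_integrand :: "complex fps list \<Rightarrow> (nat \<Rightarrow> complex) \<Rightarrow> complex" where
  "word_integrand fs z = (\<Prod>j<length fs. eval_fps (fs ! j) (exp (2 * of_real pi * \<i> * z j)))"

definition shuffle_integrand ::
    "complex fps list \<Rightarrow> complex fps list \<Rightarrow> (nat \<Rightarrow> complex) \<Rightarrow> complex" where
  "shuffle_integrand us vs z =
     (let r = length us; s = length vs in
      \<Sum>\<sigma> | \<sigma> permutes {..<r + s} \<and> strict_mono_on {..<r} \<sigma> \<and> strict_mono_on {r..<r + s} \<sigma>.
        word_integrand (map (\<lambda>j. (us @ vs) ! inv \<sigma> j) [0..<r + s]) z)"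

definition R_integrand :: "complex fps list \<Rightarrow> (nat \<Rightarrow> complex) \<Rightarrow> complex" where
  "R_integrand fs z =
     (\<Sum>i\<le>length fs. (- 1) ^ (length fs - i) *
        shuffle_integrand (take i fs) (rev (map const_part (drop i fs))) z)"

text \<open>The integral of \<open>h d\<tau>\<^sub>1 \<dots> d\<tau>\<^sub>n\<close> over \<open>\<tau>\<^sub>1 \<le> \<dots> \<le> \<tau>\<^sub>n\<close> along the path \<open>\<gamma>\<close> with parameter range \<open>T\<close>,
  as one Lebesgue integral over the parameter simplex. (Words of \<open>R_integrand\<close> need not be
  integrable individually when \<open>T\<close> is unbounded; only their combination is.)\<close>

definition iterated_integral ::
    "(real \<Rightarrow> complex) \<Rightarrow> real set \<Rightarrow> nat \<Rightarrow> ((nat \<Rightarrow> complex) \<Rightarrow> complex) \<Rightarrow> complex" where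
  "iterated_integral \<gamma> T n h =
     (LINT t : {t. t ` {..<n} \<subseteq> T \<and> mono_on {..<n} t} | (\<Pi>\<^sub>M j\<in>{..<n}. lborel).
        h (\<lambda>j. \<gamma> (t j)) * (\<Prod>j<n. vector_derivative \<gamma> (at (t j))))"

text \<open>The path from \<open>\<tau>\<close> to \<open>\<i> \<infinity>\<close> is the vertical half-line, the path from \<open>\<tau>\<close> to \<open>0\<close> the segment.\<close>

definition regularized_integral :: "complex fps list \<Rightarrow> complex \<Rightarrow> complex" where
  "regularized_integral fs \<tau> =
     (2 * of_real pi * \<i>) ^ length fs *
     (\<Sum>i\<le>length fs.
        iterated_integral (\<lambda>t. \<tau> + \<i> * of_real t) {0..} i (R_integrand (take i fs)) *
        iterated_integral (linepath \<tau> 0) {0..1} (length fs - i)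
          (word_integrand (map const_part (drop i fs))))"

definition iterated_eisenstein :: "nat list \<Rightarrow> complex \<Rightarrow> complex" where
  "iterated_eisenstein ks = regularized_integral (map eisenstein ks)"


section \<open>The algebra \<open>\<rat>[log q]((q))\<close>\<close>

text \<open>\<open>F :: rat poly fls\<close> is read as \<open>\<Sum>\<^sub>n F\<^sub>n(log q) q\<^sup>n\<close> with \<open>log q = 2 \<pi> \<i> \<tau>\<close>. The bound on the
  degree in \<open>log q\<close> makes the expansion of a function unique (lemma \<open>has_qlog_expansion_unique\<close>
  below). Without it uniqueness fails: a series of polynomials of growing degree times powers of \<open>q\<close>
  can converge absolutely to \<open>0\<close> with nonzero coefficients.\<close>

definition has_qlog_expansion :: "(complex \<Rightarrow> complex) \<Rightarrow> rat poly fls \<Rightarrow> bool" where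
  "has_qlog_expansion f F \<longleftrightarrow>
     (\<exists>d. \<forall>n. degree (fls_nth F n) \<le> d) \<and>
     (\<forall>\<tau>. Im \<tau> > 0 \<longrightarrow>
        ((\<lambda>n. poly (map_poly of_rat (fls_nth F n)) (2 * of_real pi * \<i> * \<tau>) *
              exp (2 * of_real pi * \<i> * \<tau>) powi n) has_sum f \<tau>) UNIV)"

lemma has_sum_minus:
  fixes f g :: "'a \<Rightarrow> complex"
  assumes "(f has_sum a) A" "(g has_sum b) A"
  shows "((\<lambda>x. f x - g x) has_sum (a - b)) A"
  using has_sum_add[OF assms(1) has_sum_uminusI[OF assms(2)]] by simp

lemma qlog_series_zero:
  fixes P :: "int \<Rightarrow> complex poly"
  assumes "\<And>n. degree (P n) \<le> d" "\<And>n. n < N \<Longrightarrow> P n = 0"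
    and "\<And>x. Re x < 0 \<Longrightarrow> ((\<lambda>n. poly (P n) x * exp x powi n) has_sum 0) UNIV"
  shows "P n = 0"
  using assms
proof (induction d arbitrary: P n)
  case 0
  define c where "c = (\<lambda>n. coeff (P n) 0)"
  have P: "P n = [:c n:]" for n
    using "0.prems"(1)[of n] by (auto simp: c_def elim!: degree_eq_zeroE)
  define F where "F = Abs_fps (\<lambda>k. c (N + int k))"
  have sums: "(\<lambda>k. fps_nth F k * q ^ k) sums 0" if q: "norm q < 1" "q \<noteq> 0" for q
  proof -
    have x: "Re (ln q) < 0" "exp (ln q) = q"
      using q by auto
    have "((\<lambda>n. c n * q powi n) has_sum 0) UNIV"
      using "0.prems"(3)[OF x(1)] q by (simp add: P)
    then have "((\<lambda>n. c n * q powi n) has_sum 0) (range (\<lambda>k. N + int k))"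
    proof (subst has_sum_cong_neutral[where T = UNIV and g = "\<lambda>n. c n * q powi n"])
      fix n assume "n \<in> UNIV - range (\<lambda>k. N + int k)"
      moreover have "n = N + int (nat (n - N))" if "N \<le> n" using that by simp
      ultimately have "n < N"
        by (metis DiffD2 linorder_not_less rangeI)
      then show "c n * q powi n = 0"
        using "0.prems"(2)[of n] by (simp add: c_def)
    qed auto
    then have "((\<lambda>k. c (N + int k) * q powi (N + int k)) has_sum 0) UNIV"
      by (subst (asm) has_sum_reindex) (auto simp: o_def inj_on_def)
    then have "((\<lambda>k. q powi (- N) * (c (N + int k) * q powi (N + int k))) has_sum (q powi (- N) * 0)) UNIV"
      by (rule has_sum_cmult_right)
    moreover have "q powi (- N) * (c (N + int k) * q powi (N + int k)) = fps_nth F k * q ^ k" for k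
      using q by (simp add: F_def power_int_add power_int_minus)
    ultimately show ?thesis
      by (intro has_sum_imp_sums) simp
  qed
  have "F = 0"
  proof (rule ccontr)
    assume "F \<noteq> 0"
    have "ereal (norm (1 / 2 :: complex)) \<le> fps_conv_radius F"
      unfolding fps_conv_radius_def
      by (rule conv_radius_geI) (use sums[of "1/2"] in \<open>simp add: sums_iff\<close>)
    then have r: "0 < fps_conv_radius F"
      by (rule less_le_trans[rotated]) auto
    let ?m = "subdegree F"
    define H where "H = fps_shift ?m F"
    have rH: "fps_conv_radius H = fps_conv_radius F" by (simp add: H_def)
    have "isCont (eval_fps H) 0"
      by (rule continuous_eval_fps) (use r rH in \<open>simp add: zero_ereal_def\<close>)
    then have lim: "(eval_fps H \<longlongrightarrow> eval_fps H 0) (at 0)" by (simp add: isCont_def)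
    have "eventually (\<lambda>q. q \<in> ball 0 (1/2) - {0}) (at (0::complex))"
      unfolding eventually_at by (rule exI[of _ "1/2"]) (auto simp: dist_commute)
    then have "eventually (\<lambda>q. eval_fps H q = 0) (at 0)"
    proof eventually_elim
      case (elim q)
      then have "eval_fps F q = 0" using sums[of q] by (simp add: eval_fps_def sums_iff)
      moreover have "ereal (norm q) < fps_conv_radius F"
        by (rule less_le_trans[OF _ \<open>ereal (norm (1 / 2 :: complex)) \<le> _\<close>])
           (use elim in simp)
      then have "eval_fps H q = eval_fps F q / q ^ ?m"
        unfolding H_def by (subst eval_fps_shift) (use elim in auto)
      ultimately show ?case by simp
    qed
    then have "(eval_fps H \<longlongrightarrow> 0) (at 0)"
      by (rule tendsto_eventually)
    with lim have "eval_fps H 0 = 0" using LIM_unique by blast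
    then show False using \<open>F \<noteq> 0\<close> by (simp add: H_def eval_fps_at_0)
  qed
  then have "c (N + int k) = 0" for k by (simp add: F_def fps_eq_iff)
  from this[of "nat (n - N)"] have "c n = 0"
    using "0.prems"(2)[of n] by (cases "n < N") (auto simp: c_def)
  then show ?case by (simp add: P)
next
  case (Suc d)
  let ?w = "2 * of_real pi * \<i>"
  define Q where "Q = (\<lambda>n. P n \<circ>\<^sub>p [:?w, 1:] - P n)"
  have degw: "degree [:?w, 1:] = 1" by simp
  have "degree (Q n) \<le> d" for n
  proof (rule degree_le, intro allI impI)
    fix i assume i: "d < i"
    have le: "degree (P n \<circ>\<^sub>p [:?w, 1:]) \<le> Suc d" "degree (P n) \<le> Suc d"
      using Suc.prems(1)[of n] by (simp_all add: degree_pcompose)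
    show "coeff (Q n) i = 0"
    proof (cases "i = Suc d")
      case False
      then show ?thesis using i le by (simp add: Q_def coeff_eq_0)
    next
      case True
      show ?thesis
      proof (cases "degree (P n) = Suc d")
        case False
        then show ?thesis using True le by (simp add: Q_def coeff_eq_0 degree_pcompose)
      next
        case deg: True
        have "coeff (P n \<circ>\<^sub>p [:?w, 1:]) i = lead_coeff (P n \<circ>\<^sub>p [:?w, 1:])"
          using True deg by (simp add: degree_pcompose)
        also have "\<dots> = lead_coeff (P n)"
          by (subst lead_coeff_comp) auto
        finally show ?thesis using True deg by (simp add: Q_def)
      qed
    qed
  qed
  moreover have "Q n = 0" if "n < N" for n using Suc.prems(2)[OF that] by (simp add: Q_def)
  moreover have "((\<lambda>n. poly (Q n) x * exp x powi n) has_sum 0) UNIV" if "Re x < 0" for x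
  proof -
    have "((\<lambda>n. poly (P n) (x + ?w) * exp (x + ?w) powi n - poly (P n) x * exp x powi n) has_sum (0 - 0)) UNIV"
      by (intro has_sum_minus Suc.prems(3)) (use that in auto)
    then show ?thesis by (simp add: Q_def poly_pcompose algebra_simps exp_add)
  qed
  ultimately have Q0: "Q n = 0" for n by (rule Suc.IH)
  have "P n = [:poly (P n) 0:]" for n
  proof (rule ccontr)
    assume ne: "P n \<noteq> [:poly (P n) 0:]"
    have "poly (P n) (of_nat k * ?w) = poly (P n) 0" for k
    proof (induction k)
      case (Suc k)
      have "poly (P n) (of_nat k * ?w + ?w) = poly (P n) (of_nat k * ?w)"
        using arg_cong[OF Q0[of n], of "\<lambda>p. poly p (of_nat k * ?w)"]
        by (simp add: Q_def poly_pcompose add.commute)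
      with Suc show ?case by (simp add: algebra_simps)
    qed auto
    then have "range (\<lambda>k. of_nat k * ?w) \<subseteq> {x. poly (P n - [:poly (P n) 0:]) x = 0}" by auto
    moreover have "finite {x. poly (P n - [:poly (P n) 0:]) x = 0}"
      by (rule poly_roots_finite) (use ne in simp)
    ultimately have "finite (range (\<lambda>k. of_nat k * ?w))" by (rule finite_subset)
    moreover have "inj (\<lambda>k. of_nat k * ?w)" by (auto simp: inj_on_def)
    ultimately show False using finite_imageD infinite_UNIV_nat by blast
  qed
  then have "degree (P n) \<le> d" for n by (metis degree_pCons_0 le0)
  then show ?case using Suc.IH Suc.prems(2,3) by blast
qed

lemma has_qlog_expansion_unique:
  assumes "has_qlog_expansion f F" "has_qlog_expansion f G"
  shows "F = G"
proof -
  let ?c = "map_poly (of_rat :: rat \<Rightarrow> complex)"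
  define P where "P = (\<lambda>n. ?c (fls_nth F n) - ?c (fls_nth G n))"
  from assms obtain d1 d2 where
    d: "\<And>n. degree (fls_nth F n) \<le> d1" "\<And>n. degree (fls_nth G n) \<le> d2"
    by (auto simp: has_qlog_expansion_def)
  have deg: "degree (P n) \<le> max d1 d2" for n
    unfolding P_def
    by (intro degree_diff_le) (use d[of n] in \<open>auto simp: degree_map_poly\<close>)
  have low: "P n = 0" if "n < min (fls_subdegree F) (fls_subdegree G)" for n
    using that by (simp add: P_def)
  have "((\<lambda>n. poly (P n) x * exp x powi n) has_sum 0) UNIV" if "Re x < 0" for x
  proof -
    define \<tau> where "\<tau> = x / (2 * of_real pi * \<i>)"
    have x: "2 * of_real pi * \<i> * \<tau> = x" by (simp add: \<tau>_def)
    then have "Re (2 * of_real pi * \<i> * \<tau>) < 0" using that by simp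
    then have "Im \<tau> > 0" by (simp add: zero_less_mult_iff)
    with assms have
      "((\<lambda>n. poly (?c (fls_nth F n)) x * exp x powi n) has_sum f \<tau>) UNIV"
      "((\<lambda>n. poly (?c (fls_nth G n)) x * exp x powi n) has_sum f \<tau>) UNIV"
      by (auto simp: has_qlog_expansion_def x)
    from has_sum_minus[OF this] show ?thesis by (simp add: P_def algebra_simps)
  qed
  from qlog_series_zero[of P _ "min (fls_subdegree F) (fls_subdegree G)", OF deg low this] have "?c (fls_nth F n) = ?c (fls_nth G n)" for n
    by (simp add: P_def)
  then have "fls_nth F n = fls_nth G n" for n
    by (intro poly_eqI) (metis coeff_map_poly of_rat_0 of_rat_eq_iff)
  then show ?thesis by (rule fls_eqI)
qed


section \<open>The action of \<open>Frac(\<int>[[q]])\<close>\<close>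

definition laurent_of_int_fps :: "int fps \<Rightarrow> rat fls" where
  "laurent_of_int_fps a = fps_to_fls (Abs_fps (\<lambda>n. of_int (fps_nth a n)))"

lemma laurent_of_int_fps_hom:
  "laurent_of_int_fps (a + b) = laurent_of_int_fps a + laurent_of_int_fps b"
  "laurent_of_int_fps (a * b) = laurent_of_int_fps a * laurent_of_int_fps b"
  "laurent_of_int_fps 1 = 1"
  "laurent_of_int_fps a = 0 \<longleftrightarrow> a = 0"
proof -
  show "laurent_of_int_fps (a + b) = laurent_of_int_fps a + laurent_of_int_fps b"
    unfolding laurent_of_int_fps_def fps_to_fls_plus[symmetric] fps_to_fls_eq_iff
    by (simp add: fps_eq_iff)
  show "laurent_of_int_fps (a * b) = laurent_of_int_fps a * laurent_of_int_fps b"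
    unfolding laurent_of_int_fps_def fls_times_fps_to_fls[symmetric] fps_to_fls_eq_iff
    by (simp add: fps_eq_iff fps_mult_nth)
  show "laurent_of_int_fps 1 = 1"
    unfolding laurent_of_int_fps_def fps_to_fls_eq_1_iff by (simp add: fps_eq_iff)
  show "laurent_of_int_fps a = 0 \<longleftrightarrow> a = 0"
    unfolding laurent_of_int_fps_def fps_to_fls_eq_0_iff by (simp add: fps_eq_iff)
qed

definition laurent_of_fract :: "int fps fract \<Rightarrow> rat fls" where
  "laurent_of_fract x =
     (THE y. \<exists>a b. b \<noteq> 0 \<and> x = Fract a b \<and> y = laurent_of_int_fps a / laurent_of_int_fps b)"

lemma laurent_of_fract_Fract:
  assumes "b \<noteq> 0"
  shows "laurent_of_fract (Fract a b) = laurent_of_int_fps a / laurent_of_int_fps b"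
  unfolding laurent_of_fract_def
proof (rule the_equality)
  fix y
  assume "\<exists>c d. d \<noteq> 0 \<and> Fract a b = Fract c d \<and> y = laurent_of_int_fps c / laurent_of_int_fps d"
  then obtain c d where "d \<noteq> 0" "Fract a b = Fract c d"
    and y: "y = laurent_of_int_fps c / laurent_of_int_fps d" by blast
  with assms have "a * d = c * b" by (simp add: eq_fract)
  then have "laurent_of_int_fps a * laurent_of_int_fps d = laurent_of_int_fps c * laurent_of_int_fps b"
    by (simp flip: laurent_of_int_fps_hom(2))
  with assms \<open>d \<noteq> 0\<close> show "y = laurent_of_int_fps a / laurent_of_int_fps b"
    by (simp add: y frac_eq_eq laurent_of_int_fps_hom)
qed (use assms in blast)

definition fls_const_coeffs :: "rat fls \<Rightarrow> rat poly fls" where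
  "fls_const_coeffs f = Abs_fls (\<lambda>n. [:fls_nth f n:])"

lemma fls_nth_const_coeffs [simp]: "fls_nth (fls_const_coeffs f) n = [:fls_nth f n:]"
  unfolding fls_const_coeffs_def
  by (subst nth_Abs_fls_lower_bound[of "fls_subdegree f"]) auto

lemma fls_const_coeffs_hom:
  "fls_const_coeffs (f + g) = fls_const_coeffs f + fls_const_coeffs g"
  "fls_const_coeffs (f * g) = fls_const_coeffs f * fls_const_coeffs g"
  "fls_const_coeffs 1 = 1"
proof -
  show "fls_const_coeffs (f + g) = fls_const_coeffs f + fls_const_coeffs g"
    by (simp add: fls_eq_iff)
  have "fls_subdegree (fls_const_coeffs h) = fls_subdegree h" for h
  proof (cases "h = 0")
    case False
    then show ?thesis by (intro fls_subdegree_eqI) auto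
  qed (simp add: fls_const_coeffs_def flip: zero_fls_def)
  moreover have sum: "[:sum h A:] = (\<Sum>i\<in>A. [:h i:])" for h :: "int \<Rightarrow> rat" and A
  proof (induction A rule: infinite_finite_induct)
    case (insert i A)
    have "[:sum h (insert i A):] = [:h i:] + [:sum h A:]" using insert.hyps by simp
    with insert show ?case by simp
  qed auto
  ultimately show "fls_const_coeffs (f * g) = fls_const_coeffs f * fls_const_coeffs g"
    by (simp add: fls_eq_iff fls_times_nth(2) sum mult.commute)
  show "fls_const_coeffs 1 = 1"
    by (simp add: fls_eq_iff one_pCons)
qed

definition frac_scale :: "int fps fract \<Rightarrow> rat poly fls \<Rightarrow> rat poly fls" where
  "frac_scale c F = fls_const_coeffs (laurent_of_fract c) * F"

interpretation qlog: vector_space frac_scale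
proof
  fix a b :: "int fps fract" and x y :: "rat poly fls"
  have add: "laurent_of_fract (a + b) = laurent_of_fract a + laurent_of_fract b"
    by (cases a; cases b)
       (simp add: laurent_of_fract_Fract laurent_of_int_fps_hom add_frac_eq)
  have mult: "laurent_of_fract (a * b) = laurent_of_fract a * laurent_of_fract b"
    by (cases a; cases b) (simp add: laurent_of_fract_Fract laurent_of_int_fps_hom)
  have one: "laurent_of_fract 1 = 1"
    by (simp add: One_fract_def laurent_of_fract_Fract laurent_of_int_fps_hom)
  show "frac_scale a (x + y) = frac_scale a x + frac_scale a y"
    by (simp add: frac_scale_def algebra_simps)
  show "frac_scale (a + b) x = frac_scale a x + frac_scale b x"
    by (simp add: frac_scale_def add fls_const_coeffs_hom algebra_simps)
  show "frac_scale a (frac_scale b x) = frac_scale (a * b) x"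
    by (simp add: frac_scale_def mult fls_const_coeffs_hom mult.assoc)
  show "frac_scale 1 x = x"
    by (simp add: frac_scale_def one fls_const_coeffs_hom)
qed

end

theory Submission
  imports Defs "HOL-Real_Asymp.Real_Asymp"
begin

text \<open>
  Write \<open>D = q d/dq\<close>, extended by \<open>D (log q) = 1\<close>. The regularized integral of a word \<open>f\<^sub>1 \<dots> f\<^sub>n\<close>
  satisfies \<open>D (I(f\<^sub>1, \<dots>, f\<^sub>n)) = - f\<^sub>1 I(f\<^sub>2, \<dots>, f\<^sub>n)\<close>: the integral of \<open>R[f\<^sub>1 | \<dots> | f\<^sub>i]\<close> from
  \<open>\<tau>\<close> to \<open>\<i> \<infinity>\<close> is a power series in \<open>q\<close>, and the integral of the constant parts from \<open>\<tau>\<close> to \<open>0\<close> is a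
  monomial in \<open>log q\<close>. Applying \<open>D\<close> to a linear relation of minimal size over a differential field
  \<open>K\<close> gives a smaller one, hence a trivial one, and its top coefficients say that some nontrivial
  combination of the letters with constant coefficients is the derivative of an element of \<open>K\<close>.

  For \<open>K = Frac(\<int>[[q]])\<close> and Eisenstein series this is impossible: an element of \<open>K\<close> has only
  finitely many primes in the denominators of its coefficients, so \<open>p\<^sup>j\<close> divides
  \<open>\<Sum>\<^sub>k s\<^sub>k \<sigma>\<^sub>2\<^sub>k\<^sub>-\<^sub>1(p\<^sup>j)\<close> for almost all primes \<open>p\<close> and all \<open>j\<close>, which forces \<open>s\<^sub>k = 0\<close>.
\<close>

section \<open>Shuffles and the operator \<open>R\<close>\<close>

text \<open>\<open>D\<close> is never extended to the whole algebra. A scalar from \<open>K\<close>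
  contains no \<open>log q\<close>, so a relation splits into one relation in \<open>rat fls\<close>
  for each power of \<open>log q\<close>; the rule for \<open>D (log q)\<close> survives as the term
  \<open>of_nat (Suc m) * E (Suc m) w\<close>, which links neighbouring powers. In the derivative of
  a relation these links cancel, because the relation at \<open>Suc m\<close> holds as well. The
  power p^j comes from \<open>D h\<close> having coefficient n h_n at q^n, taken at n = p^j; the
  denominators of all the h_n divide powers of one integer, the leading coefficient of the
  denominator of h. The elements of \<open>K\<close> killed by \<open>D\<close> are rational
  numbers, so the s_k become integers once a common denominator is cleared. Weight 0 is invisible at
  q^(p^j), since G_0 = -1; it is excluded by the constant term, which vanishes in
  \<open>D h\<close>. Only divisor sums enter in positive weight, so weight 2 is treated like the
  others.\<close>

fun shuffle_eval :: "complex fps list \<Rightarrow> complex fps list \<Rightarrow> (nat \<Rightarrow> complex) \<Rightarrow> complex" where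
  "shuffle_eval [] vs z = word_integrand vs z"
| "shuffle_eval us [] z = word_integrand us z"
| "shuffle_eval (u # us) (v # vs) z =
     eval_fps u (exp (2 * of_real pi * \<i> * z 0)) * shuffle_eval us (v # vs) (z \<circ> Suc) +
     eval_fps v (exp (2 * of_real pi * \<i> * z 0)) * shuffle_eval (u # us) vs (z \<circ> Suc)"

lemma word_integrand_Nil [simp]: "word_integrand [] z = 1"
  by (simp add: word_integrand_def)

lemma word_integrand_Cons:
  "word_integrand (f # fs) z =
     eval_fps f (exp (2 * of_real pi * \<i> * z 0)) * word_integrand fs (z \<circ> Suc)"
  unfolding word_integrand_def by (simp add: prod.lessThan_Suc_shift del: prod.lessThan_Suc)

lemma shuffle_eval_Nil2 [simp]: "shuffle_eval us [] z = word_integrand us z"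
  by (cases us) auto

text \<open>\<open>shuffles\<close> is a set and would merge equal words. The letters are therefore
  labels, sent to power series by \<open>g\<close>; for disjoint labels the words starting in
  \<open>xs\<close> and those starting in \<open>ys\<close> form disjoint sets, and the sum obeys
  the recursion of \<open>shuffle_eval\<close>.\<close>

lemma sum_shuffles_word_integrand:
  assumes "set xs \<inter> set ys = {}"
  shows "(\<Sum>w\<in>shuffles xs ys. word_integrand (map g w) z) = shuffle_eval (map g xs) (map g ys) z"
  using assms
proof (induction xs ys arbitrary: z rule: shuffles.induct)
  case (3 x xs y ys)
  have "(\<Sum>w\<in>shuffles (x # xs) (y # ys). word_integrand (map g w) z) =
      (\<Sum>w\<in>(#) x ` shuffles xs (y # ys). word_integrand (map g w) z) +
      (\<Sum>w\<in>(#) y ` shuffles (x # xs) ys. word_integrand (map g w) z)"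
    unfolding shuffles.simps by (rule sum.union_disjoint) (use "3.prems" in auto)
  also have "\<dots> = shuffle_eval (map g (x # xs)) (map g (y # ys)) z"
    using 3 by (simp add: sum.reindex word_integrand_Cons flip: sum_distrib_left)
  finally show ?case .
qed auto

lemma sorted_wrt_filter_iff:
  "sorted_wrt (<) (filter P xs) \<longleftrightarrow>
     (\<forall>i j. i < j \<longrightarrow> j < length xs \<longrightarrow> P (xs ! i) \<longrightarrow> P (xs ! j) \<longrightarrow> xs ! i < xs ! j)"
  for xs :: "'a::linorder list"
proof -
  have "sorted_wrt (<) (filter P xs) \<longleftrightarrow> sorted_wrt (\<lambda>x y. P x \<longrightarrow> P y \<longrightarrow> x < y) xs"
    by (induction xs) auto
  then show ?thesis by (simp add: sorted_wrt_iff_nth_less)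
qed

text \<open>A value sits in the list at the position given by \<open>inv \<tau>\<close>, so a block
  of values appears in order when these positions increase. With
  \<open>\<tau> = inv \<sigma>\<close> the monotonicity demanded of \<open>\<sigma>\<close> becomes
  a property of the permuted list.\<close>

lemma filter_permutation_eq_upt_iff:
  fixes \<tau> :: "nat \<Rightarrow> nat"
  assumes "\<tau> permutes {..<n}" "b \<le> n"
    and P: "\<And>j. j < n \<Longrightarrow> P j \<longleftrightarrow> a \<le> j \<and> j < b"
  shows "filter P (map \<tau> [0..<n]) = [a..<b] \<longleftrightarrow> strict_mono_on {a..<b} (inv \<tau>)"
proof -
  have lt: "\<tau> i < n \<longleftrightarrow> i < n" "inv \<tau> i < n \<longleftrightarrow> i < n" for i
    using permutes_in_image[OF assms(1), of i] permutes_in_image[OF permutes_inv[OF assms(1)], of i]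
    by auto
  note inv = permutes_inverses[OF assms(1)]
  have set_eq: "set (filter P (map \<tau> [0..<n])) = {a..<b}"
  proof -
    have "set (map \<tau> [0..<n]) = {..<n}"
      using permutes_image[OF assms(1)] by (simp add: lessThan_atLeast0)
    moreover have "set (filter P (map \<tau> [0..<n])) = {x \<in> set (map \<tau> [0..<n]). P x}" by simp
    ultimately show ?thesis using P assms(2) by auto
  qed
  have "filter P (map \<tau> [0..<n]) = [a..<b] \<longleftrightarrow> sorted_wrt (<) (filter P (map \<tau> [0..<n]))"
  proof
    assume "sorted_wrt (<) (filter P (map \<tau> [0..<n]))"
    then show "filter P (map \<tau> [0..<n]) = [a..<b]"
      by (intro strict_sorted_equal) (use set_eq in auto)
  qed (metis sorted_wrt_upt)
  also have "\<dots> \<longleftrightarrow> (\<forall>i j. i < j \<longrightarrow> j < n \<longrightarrow> P (\<tau> i) \<longrightarrow> P (\<tau> j) \<longrightarrow> \<tau> i < \<tau> j)"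
    by (simp add: sorted_wrt_filter_iff)
  also have "\<dots> \<longleftrightarrow> strict_mono_on {a..<b} (inv \<tau>)"
  proof
    assume *: "\<forall>i j. i < j \<longrightarrow> j < n \<longrightarrow> P (\<tau> i) \<longrightarrow> P (\<tau> j) \<longrightarrow> \<tau> i < \<tau> j"
    show "strict_mono_on {a..<b} (inv \<tau>)"
    proof (rule strict_mono_onI, rule ccontr)
      fix r s assume rs: "r \<in> {a..<b}" "s \<in> {a..<b}" "r < s" "\<not> inv \<tau> r < inv \<tau> s"
      moreover have "inv \<tau> s \<noteq> inv \<tau> r"
        using rs(3) inv(1)[of r] inv(1)[of s] by auto
      ultimately have less: "inv \<tau> s < inv \<tau> r" by simp
      have "r < n" "s < n" using rs assms(2) by auto
      then have "s < r"
        using *[rule_format, OF less] lt(2)[of r] P[of r] P[of s] rs inv(1)[of r] inv(1)[of s] by simp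
      with rs show False by simp
    qed
  next
    assume *: "strict_mono_on {a..<b} (inv \<tau>)"
    show "\<forall>i j. i < j \<longrightarrow> j < n \<longrightarrow> P (\<tau> i) \<longrightarrow> P (\<tau> j) \<longrightarrow> \<tau> i < \<tau> j"
    proof (intro allI impI, rule ccontr)
      fix i j assume ij: "i < j" "j < n" "P (\<tau> i)" "P (\<tau> j)" "\<not> \<tau> i < \<tau> j"
      moreover have "\<tau> j \<noteq> \<tau> i"
        using ij(1) inv(2)[of i] inv(2)[of j] by auto
      ultimately have "\<tau> j < \<tau> i" by simp
      moreover have "\<tau> i \<in> {a..<b}" "\<tau> j \<in> {a..<b}" using ij P lt by auto
      ultimately have "inv \<tau> (\<tau> j) < inv \<tau> (\<tau> i)"
        by (intro strict_mono_onD[OF *])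
      with ij inv show False by simp
    qed
  qed
  finally show ?thesis .
qed

lemma in_shuffles_upt_iff:
  "w \<in> shuffles [0..<r] [r..<r + s] \<longleftrightarrow>
     filter (\<lambda>j. j < r) w = [0..<r] \<and> filter (\<lambda>j. \<not> j < r) w = [r..<r + s]"
  using inv_image_partition[of "[0..<r]" "\<lambda>j. j < r" "[r..<r + s]"] by (auto simp: o_def)

text \<open>Trades the sum over permutations for a recursion on first letters. Words are spelled in
  positions 0, ..., r + s - 1, so that a permutation determines exactly one word even when power
  series repeat.\<close>

lemma shuffle_integrand_eq: "shuffle_integrand us vs z = shuffle_eval us vs z"
proof -
  define r s where rs: "r = length us" "s = length vs"
  let ?g = "\<lambda>j. (us @ vs) ! j"
  let ?S = "shuffles [0..<r] [r..<r + s]"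
  let ?A = "{\<sigma>. \<sigma> permutes {..<r + s} \<and> strict_mono_on {..<r} \<sigma> \<and> strict_mono_on {r..<r + s} \<sigma>}"
  have iff: "map \<tau> [0..<r + s] \<in> ?S \<longleftrightarrow>
      strict_mono_on {..<r} (inv \<tau>) \<and> strict_mono_on {r..<r + s} (inv \<tau>)"
    if "\<tau> permutes {..<r + s}" for \<tau>
    unfolding in_shuffles_upt_iff
    using filter_permutation_eq_upt_iff[OF that, of r "\<lambda>j. j < r" 0]
      filter_permutation_eq_upt_iff[OF that, of "r + s" "\<lambda>j. \<not> j < r" r]
    by (auto simp: lessThan_atLeast0 not_less)
  have bij: "bij_betw (\<lambda>\<sigma>. map (inv \<sigma>) [0..<r + s]) ?A ?S"
    unfolding bij_betw_def
  proof (intro conjI subset_antisym subsetI inj_onI)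
    fix \<sigma> \<sigma>' assume *: "\<sigma> \<in> ?A" "\<sigma>' \<in> ?A"
      "map (inv \<sigma>) [0..<r + s] = map (inv \<sigma>') [0..<r + s]"
    then have p: "inv \<sigma> permutes {..<r + s}" "inv \<sigma>' permutes {..<r + s}"
      by (auto intro: permutes_inv)
    have "inv \<sigma> = inv \<sigma>'"
    proof
      fix x show "inv \<sigma> x = inv \<sigma>' x"
      proof (cases "x < r + s")
        case True
        with *(3) show ?thesis by simp
      next
        case False
        then show ?thesis using permutes_not_in[OF p(1)] permutes_not_in[OF p(2)] by simp
      qed
    qed
    then have "inv (inv \<sigma>) = inv (inv \<sigma>')" by simp
    moreover have "inv (inv \<sigma>) = \<sigma>" "inv (inv \<sigma>') = \<sigma>'"
      using * by (auto intro: permutes_inv_inv)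
    ultimately show "\<sigma> = \<sigma>'" by simp
  next
    fix w assume "w \<in> (\<lambda>\<sigma>. map (inv \<sigma>) [0..<r + s]) ` ?A"
    then show "w \<in> ?S" using iff[OF permutes_inv] by (auto simp: permutes_inv_inv)
  next
    fix w assume w: "w \<in> ?S"
    have len: "length w = r + s" using length_shuffles[OF w] by simp
    have "distinct w" using w by (intro distinct_disjoint_shuffles[OF _ _ _ w]) auto
    have set: "set w = {..<r + s}" using set_shuffles[OF w] by auto
    \<comment> \<open>A shuffle of the positions lists the values of \<open>inv \<sigma>\<close>;
      outside the range it has to be continued by the identity to be a permutation.\<close>
    define \<tau> where "\<tau> = (\<lambda>j. if j < r + s then w ! j else j)"
    have \<tau>: "\<tau> permutes {..<r + s}"
    proof (rule bij_imp_permutes)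
      have "bij_betw ((!) w) {..<length w} (set w)"
        using \<open>distinct w\<close> by (rule bij_betw_nth) auto
      then show "bij_betw \<tau> {..<r + s} {..<r + s}"
        unfolding len set by (rule bij_betw_cong[THEN iffD1, rotated]) (simp add: \<tau>_def)
    qed (simp add: \<tau>_def)
    have "w = map \<tau> [0..<r + s]" by (rule nth_equalityI) (simp_all add: len \<tau>_def)
    with iff[OF \<tau>] w have "inv \<tau> \<in> ?A" "w = map (inv (inv \<tau>)) [0..<r + s]"
      using \<tau> by (auto simp: permutes_inv permutes_inv_inv)
    then show "w \<in> (\<lambda>\<sigma>. map (inv \<sigma>) [0..<r + s]) ` ?A" by blast
  qed
  have "shuffle_integrand us vs z = (\<Sum>\<sigma>\<in>?A. word_integrand (map ?g (map (inv \<sigma>) [0..<r + s])) z)"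
    by (simp add: shuffle_integrand_def Let_def rs o_def)
  also have "\<dots> = (\<Sum>w\<in>?S. word_integrand (map ?g w) z)"
    by (rule sum.reindex_bij_betw[OF bij])
  also have "\<dots> = shuffle_eval (map ?g [0..<r]) (map ?g [r..<r + s]) z"
    by (rule sum_shuffles_word_integrand) auto
  also have "map ?g [0..<r] = us" by (rule nth_equalityI) (auto simp: rs nth_append)
  also have "map ?g [r..<r + s] = vs" by (rule nth_equalityI) (auto simp: rs nth_append)
  finally show ?thesis .
qed

lemma shuffle_eval_first_letter:
  assumes "us \<noteq> [] \<or> vs \<noteq> []"
  shows "shuffle_eval us vs z =
    (if us = [] then 0 else eval_fps (hd us) (exp (2 * of_real pi * \<i> * z 0)) * shuffle_eval (tl us) vs (z \<circ> Suc)) +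
    (if vs = [] then 0 else eval_fps (hd vs) (exp (2 * of_real pi * \<i> * z 0)) * shuffle_eval us (tl vs) (z \<circ> Suc))"
  using assms by (cases us; cases vs) (auto simp: word_integrand_Cons)

lemma R_integrand_Nil [simp]: "R_integrand [] z = 1"
  by (simp add: R_integrand_def shuffle_integrand_eq)

text \<open>Reversal puts the constant part of the last letter in front, so every shuffled word
  starts with \<open>f\<close> or with that constant. Removing \<open>f\<close> leaves the terms of
  \<open>R_integrand fs\<close>; removing the constant leaves those of
  \<open>R_integrand (butlast (f # fs))\<close> with the opposite sign, because the exponent of -1
  counts constant letters.\<close>

lemma R_integrand_Cons:
  "R_integrand (f # fs) z =
     eval_fps f (exp (2 * of_real pi * \<i> * z 0)) * R_integrand fs (z \<circ> Suc) -
     fps_nth (last (f # fs)) 0 * R_integrand (butlast (f # fs)) (z \<circ> Suc)"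
proof -
  let ?e = "exp (2 * of_real pi * \<i> * z 0)" and ?n = "length fs" and ?l = "f # fs"
  let ?V = "\<lambda>l i. rev (map const_part (drop i l))"
  \<comment> \<open>\<open>A\<close> collects the words starting with \<open>f\<close>,
    \<open>B\<close> those starting with a constant. No letter \<open>f\<close> is present at
    \<open>i = 0\<close> and no constant letter at \<open>i = Suc ?n\<close>, hence the zero
    values.\<close>
  define A where "A i = (if i = 0 then 0 else
      eval_fps f ?e * shuffle_eval (take (i - 1) fs) (?V fs (i - 1)) (z \<circ> Suc))" for i
  define B where "B i = (if i = Suc ?n then 0 else
      fps_nth (last ?l) 0 * shuffle_eval (take i (butlast ?l)) (?V (butlast ?l) i) (z \<circ> Suc))" for i
  have AB: "shuffle_eval (take i ?l) (?V ?l i) z = A i + B i" if "i \<le> Suc ?n" for i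
  proof -
    have 1: "hd (take i ?l) = f \<and> tl (take i ?l) = take (i - 1) fs \<and> ?V ?l i = ?V fs (i - 1)" if "i \<noteq> 0"
      using that by (cases i) auto
    have 2: "hd (?V ?l i) = const_part (last ?l) \<and> tl (?V ?l i) = ?V (butlast ?l) i
        \<and> take i ?l = take i (butlast ?l)" if "i \<noteq> Suc ?n"
    proof -
      from that \<open>i \<le> Suc ?n\<close> have i: "i < length ?l" by simp
      then have ne: "drop i ?l \<noteq> []" by simp
      have "last (drop i ?l) = last ?l" using i by (rule last_drop)
      moreover have "?V ?l i = const_part (last (drop i ?l)) # rev (map const_part (butlast (drop i ?l)))"
        using ne by (cases "drop i ?l" rule: rev_cases) (simp_all del: drop_Cons')
      moreover have "take i ?l = take i (butlast ?l)" using i by (simp add: take_butlast del: butlast.simps)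
      ultimately show ?thesis by (simp add: butlast_drop del: butlast.simps)
    qed
    have "shuffle_eval (take i ?l) (?V ?l i) z =
      (if take i ?l = [] then 0 else eval_fps (hd (take i ?l)) ?e * shuffle_eval (tl (take i ?l)) (?V ?l i) (z \<circ> Suc)) +
      (if ?V ?l i = [] then 0 else eval_fps (hd (?V ?l i)) ?e * shuffle_eval (take i ?l) (tl (?V ?l i)) (z \<circ> Suc))"
      by (rule shuffle_eval_first_letter) auto
    moreover have "take i ?l = [] \<longleftrightarrow> i = 0" "?V ?l i = [] \<longleftrightarrow> i = Suc ?n" using that by auto
    ultimately show ?thesis
      unfolding A_def B_def using 1 2 by (auto simp: const_part_def)
  qed
  have "R_integrand ?l z = (\<Sum>i\<le>Suc ?n. (-1) ^ (Suc ?n - i) * (A i + B i))"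
    unfolding R_integrand_def shuffle_integrand_eq by (intro sum.cong) (use AB in auto)
  also have "\<dots> = (\<Sum>i\<le>Suc ?n. (-1) ^ (Suc ?n - i) * A i) + (\<Sum>i\<le>Suc ?n. (-1) ^ (Suc ?n - i) * B i)"
    by (simp only: distrib_left sum.distrib)
  also have "(\<Sum>i\<le>Suc ?n. (-1) ^ (Suc ?n - i) * A i) = eval_fps f ?e * R_integrand fs (z \<circ> Suc)"
    unfolding R_integrand_def shuffle_integrand_eq
    by (subst sum.atMost_Suc_shift) (simp add: A_def sum_distrib_left mult_ac)
  also have "(\<Sum>i\<le>Suc ?n. (-1) ^ (Suc ?n - i) * B i) =
      - (fps_nth (last ?l) 0 * R_integrand (butlast ?l) (z \<circ> Suc))"
  proof -
    have "(-1) ^ (Suc ?n - i) * B i = - (fps_nth (last ?l) 0 * ((-1) ^ (length (butlast ?l) - i) *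
        shuffle_eval (take i (butlast ?l)) (?V (butlast ?l) i) (z \<circ> Suc)))" if "i \<le> ?n" for i
      using that by (simp add: B_def Suc_diff_le del: butlast.simps last.simps)
    then have "(\<Sum>i\<le>?n. (-1) ^ (Suc ?n - i) * B i) =
        - (fps_nth (last ?l) 0 * R_integrand (butlast ?l) (z \<circ> Suc))"
      unfolding R_integrand_def shuffle_integrand_eq sum_distrib_left sum_negf[symmetric]
      by (intro sum.cong) (simp_all del: butlast.simps last.simps)
    then show ?thesis by (simp add: B_def del: butlast.simps last.simps)
  qed
  finally show ?thesis by (simp only: diff_conv_add_uminus)
qed

section \<open>Integrals over ordered simplices\<close>

abbreviation (input) lborel_pow :: "nat set \<Rightarrow> (nat \<Rightarrow> real) measure" where
  "lborel_pow I \<equiv> (\<Pi>\<^sub>M j\<in>I. lborel)"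

interpretation lborel_pow: product_sigma_finite "\<lambda>_::nat. lborel :: real measure"
  by standard

text \<open>The product formula integrates the new coordinate innermost, but on a simplex the first
  coordinate bounds all others and must be outermost. The exchange needs integrability on the pair,
  obtained from that of \<open>f\<close> by applying Tonelli to the norm.\<close>

lemma integral_lborel_pow_insert:
  fixes f :: "(nat \<Rightarrow> real) \<Rightarrow> 'a::{banach, second_countable_topology}"
  assumes I: "finite I" "i \<notin> I" and f: "integrable (lborel_pow (insert i I)) f"
  shows "integral\<^sup>L (lborel_pow (insert i I)) f = (\<integral>s. (\<integral>t. f (t(i := s)) \<partial>lborel_pow I) \<partial>lborel)"
    and "integrable lborel (\<lambda>s. \<integral>t. f (t(i := s)) \<partial>lborel_pow I)"
proof -
  interpret I: finite_product_sigma_finite "\<lambda>_. lborel" I by standard (rule I)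
  interpret P: pair_sigma_finite "lborel_pow I" "lborel :: real measure" ..
  have [measurable]: "f \<in> borel_measurable (lborel_pow (insert i I))" using f by simp
  have meas: "(\<lambda>(t, s). f (t(i := s))) \<in> borel_measurable (lborel_pow I \<Otimes>\<^sub>M lborel)"
    using measurable_compose[OF measurable_add_dim \<open>f \<in> _\<close>] by (simp add: case_prod_unfold)
  have "(\<integral>\<^sup>+x. ennreal (norm (case x of (t, s) \<Rightarrow> f (t(i := s)))) \<partial>(lborel_pow I \<Otimes>\<^sub>M lborel)) =
      (\<integral>\<^sup>+t. \<integral>\<^sup>+s. ennreal (norm (f (t(i := s)))) \<partial>lborel \<partial>lborel_pow I)"
    using meas by (subst lborel.nn_integral_fst[symmetric]) auto
  also have "\<dots> = (\<integral>\<^sup>+t. ennreal (norm (f t)) \<partial>lborel_pow (insert i I))"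
    by (rule lborel_pow.product_nn_integral_insert[symmetric]) (use I in auto)
  also have "\<dots> < \<infinity>" using f by (simp add: integrable_iff_bounded)
  finally have int: "integrable (lborel_pow I \<Otimes>\<^sub>M lborel) (\<lambda>(t, s). f (t(i := s)))"
    using meas by (simp add: integrable_iff_bounded)
  show "integrable lborel (\<lambda>s. \<integral>t. f (t(i := s)) \<partial>lborel_pow I)"
    by (rule P.integrable_snd[OF int])
  show "integral\<^sup>L (lborel_pow (insert i I)) f = (\<integral>s. (\<integral>t. f (t(i := s)) \<partial>lborel_pow I) \<partial>lborel)"
    unfolding lborel_pow.product_integral_insert[OF I f] P.Fubini_integral[OF int] ..
qed

text \<open>The coordinates are indexed by \<open>{a..<a + n}\<close> with arbitrary \<open>a\<close>, so that splitting off the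
  first one by Fubini's theorem needs no reindexing of product measures.\<close>

definition ordered_simplex :: "real set \<Rightarrow> nat \<Rightarrow> nat \<Rightarrow> real \<Rightarrow> (nat \<Rightarrow> real) set" where
  "ordered_simplex U a n y =
     {t. (\<forall>j\<in>{a..<a + n}. t j \<in> U \<and> y \<le> t j) \<and> mono_on {a..<a + n} t}"

lemma ordered_simplex_0 [simp]: "t \<in> ordered_simplex U a 0 y"
  by (simp add: ordered_simplex_def mono_on_def)

text \<open>The reason for the parameter \<open>y\<close>: once the first coordinate is fixed at
  \<open>s\<close>, the remaining ones form a simplex of the same kind with lower bound
  \<open>s\<close>.\<close>

lemma ordered_simplex_Suc_iff:
  "t(a := s) \<in> ordered_simplex U a (Suc n) y \<longleftrightarrow>
     s \<in> U \<and> y \<le> s \<and> t \<in> ordered_simplex U (Suc a) n s"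
proof -
  let ?I = "{Suc a..<Suc a + n}"
  have ins: "{a..<a + Suc n} = insert a ?I" by auto
  have upd: "(t(a := s)) j = t j" if "j \<in> ?I" for j using that by auto
  have "mono_on (insert a ?I) (t(a := s)) \<longleftrightarrow> (\<forall>j\<in>?I. s \<le> t j) \<and> mono_on ?I t"
  proof
    assume *: "mono_on (insert a ?I) (t(a := s))"
    show "(\<forall>j\<in>?I. s \<le> t j) \<and> mono_on ?I t"
    proof (intro conjI ballI mono_onI)
      fix j assume "j \<in> ?I"
      with mono_onD[OF *, of a j] upd[of j] show "s \<le> t j" by auto
    next
      fix i j assume "i \<in> ?I" "j \<in> ?I" "i \<le> j"
      with mono_onD[OF *, of i j] upd[of i] upd[of j] show "t i \<le> t j" by simp
    qed
  next
    assume *: "(\<forall>j\<in>?I. s \<le> t j) \<and> mono_on ?I t"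
    show "mono_on (insert a ?I) (t(a := s))"
    proof (intro mono_onI)
      fix i j assume "i \<in> insert a ?I" "j \<in> insert a ?I" "i \<le> j"
      with * mono_onD[of ?I t i j] show "(t(a := s)) i \<le> (t(a := s)) j" by auto
    qed
  qed
  moreover have "(\<forall>j\<in>insert a ?I. (t(a := s)) j \<in> U \<and> y \<le> (t(a := s)) j) \<longleftrightarrow>
      s \<in> U \<and> y \<le> s \<and> (\<forall>j\<in>?I. t j \<in> U \<and> y \<le> t j)"
    by auto
  moreover have "y \<le> t j" if "y \<le> s" "\<forall>j\<in>?I. s \<le> t j" "j \<in> ?I" for j
    using that order_trans by blast
  ultimately show ?thesis
    unfolding ordered_simplex_def ins mem_Collect_eq by blast
qed

lemma measurable_ordered_simplex [measurable]:
  assumes "U \<in> sets borel"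
  shows "Measurable.pred (lborel_pow {a..<a + n}) (\<lambda>t. t \<in> ordered_simplex U a n y)"
proof -
  have *: "(\<lambda>t. t \<in> ordered_simplex U a n y) = (\<lambda>t. (\<forall>j\<in>{a..<a + n}. t j \<in> U \<and> y \<le> t j) \<and>
      (\<forall>i\<in>{a..<a + n}. \<forall>j\<in>{a..<a + n}. i \<le> j \<longrightarrow> t i \<le> t j))"
    unfolding ordered_simplex_def mono_on_def by auto
  let ?M = "lborel_pow {a..<a + n}"
  have comp: "(\<lambda>t. t j) \<in> borel_measurable ?M" if "j \<in> {a..<a + n}" for j
    using measurable_component_singleton[OF that, of "\<lambda>_. lborel"] by simp
  have "Measurable.pred borel (\<lambda>x::real. x \<in> U \<and> y \<le> x)"
    using assms by (simp add: pred_def)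
  then have range: "Measurable.pred ?M (\<lambda>t. t j \<in> U \<and> y \<le> t j)" if "j \<in> {a..<a + n}" for j
    by (rule measurable_compose[OF comp[OF that]])
  have mono: "Measurable.pred ?M (\<lambda>t. i \<le> j \<longrightarrow> t i \<le> t j)"
    if "i \<in> {a..<a + n}" "j \<in> {a..<a + n}" for i j
    using borel_measurable_le[OF comp[OF that(1)] comp[OF that(2)]]
    by (cases "i \<le> j") (simp_all add: pred_def)
  show ?thesis
    unfolding * by (rule pred_intros_logic(3); intro pred_intros_finite(3) finite_atLeastLessThan range mono)
qed

text \<open>A product of integrable functions of one variable each is integrable for the product
  measure, so a bound of this shape on the simplex suffices.\<close>

lemma integrable_ordered_simplex:
  fixes h :: "(nat \<Rightarrow> real) \<Rightarrow> 'a::{banach, second_countable_topology}"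
  assumes "U \<in> sets borel" and h: "h \<in> borel_measurable (lborel_pow {a..<a + n})"
    and g: "integrable lborel g"
    and le: "\<And>t. t \<in> ordered_simplex U a n y \<Longrightarrow> norm (h t) \<le> C * (\<Prod>j\<in>{a..<a + n}. g (t j))"
    and nonneg: "\<And>x. g x \<ge> (0::real)" "C \<ge> 0"
  shows "integrable (lborel_pow {a..<a + n}) (\<lambda>t. indicator (ordered_simplex U a n y) t *\<^sub>R h t)"
proof (rule Bochner_Integration.integrable_bound)
  show "integrable (lborel_pow {a..<a + n}) (\<lambda>t. C * (\<Prod>j\<in>{a..<a + n}. g (t j)))"
    by (intro integrable_mult_right lborel_pow.product_integrable_prod) (use g in auto)
  note [measurable] = h assms(1)
  show "(\<lambda>t. indicator (ordered_simplex U a n y) t *\<^sub>R h t) \<in> borel_measurable (lborel_pow {a..<a + n})"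
    by measurable
  show "AE t in lborel_pow {a..<a + n}.
      norm (indicator (ordered_simplex U a n y) t *\<^sub>R h t) \<le> norm (C * (\<Prod>j\<in>{a..<a + n}. g (t j)))"
    using le by (intro AE_I2) (auto simp: indicator_def abs_mult nonneg prod_nonneg)
qed

lemma integral_ordered_simplex_Suc:
  fixes h :: "(nat \<Rightarrow> real) \<Rightarrow> 'a::{banach, second_countable_topology}"
  assumes "integrable (lborel_pow {a..<a + Suc n}) (\<lambda>t. indicator (ordered_simplex U a (Suc n) y) t *\<^sub>R h t)"
  shows "(\<integral>t. indicator (ordered_simplex U a (Suc n) y) t *\<^sub>R h t \<partial>lborel_pow {a..<a + Suc n}) =
      (\<integral>s. indicator (U \<inter> {y..}) s *\<^sub>R
         (\<integral>t. indicator (ordered_simplex U (Suc a) n s) t *\<^sub>R h (t(a := s)) \<partial>lborel_pow {Suc a..<Suc a + n}) \<partial>lborel)"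
    (is "?A = (\<integral>s. ?B s \<partial>lborel)")
    and "integrable lborel (\<lambda>s. indicator (U \<inter> {y..}) s *\<^sub>R
         (\<integral>t. indicator (ordered_simplex U (Suc a) n s) t *\<^sub>R h (t(a := s)) \<partial>lborel_pow {Suc a..<Suc a + n}))"
proof -
  have ins: "{a..<a + Suc n} = insert a {Suc a..<Suc a + n}" by auto
  have eq: "(\<integral>t. indicator (ordered_simplex U a (Suc n) y) (t(a := s)) *\<^sub>R h (t(a := s))
      \<partial>lborel_pow {Suc a..<Suc a + n}) = ?B s" for s
    unfolding indicator_def ordered_simplex_Suc_iff
    by (auto intro!: Bochner_Integration.integral_cong)
  note fub = integral_lborel_pow_insert[OF _ _ assms[unfolded ins], unfolded eq]
  show "?A = (\<integral>s. ?B s \<partial>lborel)" "integrable lborel ?B"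
    unfolding ins using fub by auto
qed

text \<open>The volume over a fixed first coordinate \<open>s\<close> is known by induction and is
  integrated over \<open>s\<close> from \<open>y\<close> to 1; the lower bound has to vary for
  this.\<close>

lemma integral_ordered_simplex_unit:
  assumes "0 \<le> y" "y \<le> 1"
  shows "(\<integral>t. indicator (ordered_simplex {..1} a n y) t \<partial>lborel_pow {a..<a + n}) = (1 - y) ^ n / fact n"
  using assms
proof (induction n arbitrary: a y)
  case 0
  show ?case by (simp add: lborel_pow.product_integral_prod PiM_empty lebesgue_integral_count_space_finite)
next
  case (Suc n)
  have "integrable (lborel_pow {a..<a + Suc n}) (\<lambda>t. indicator (ordered_simplex {..1} a (Suc n) y) t *\<^sub>R (1::real))"
    by (rule integrable_ordered_simplex[where C = 1 and g = "indicator {y..1}"])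
       (auto simp: ordered_simplex_def emeasure_lborel_Icc_eq)
  note step = integral_ordered_simplex_Suc(1)[OF this]
  have "(\<integral>t. indicat_real (ordered_simplex {..1} a (Suc n) y) t \<partial>lborel_pow {a..<a + Suc n}) =
     (\<integral>s. indicator ({..1} \<inter> {y..}) s *\<^sub>R
         (\<integral>t. indicat_real (ordered_simplex {..1} (Suc a) n s) t \<partial>lborel_pow {Suc a..<Suc a + n}) \<partial>lborel)"
    using step by (simp only: real_scaleR_def mult_1_right)
  also have "\<dots> = (\<integral>s. ((1 - s) ^ n / fact n) * indicator {y..1} s \<partial>lborel)"
  proof (rule Bochner_Integration.integral_cong[OF refl])
    fix s :: real
    let ?J = "\<integral>t. indicat_real (ordered_simplex {..1} (Suc a) n s) t \<partial>lborel_pow {Suc a..<Suc a + n}"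
    have J: "?J = (1 - s) ^ n / fact n" if "s \<in> {y..1}"
      by (rule Suc.IH) (use that Suc.prems in auto)
    show "indicator ({..1} \<inter> {y..}) s *\<^sub>R ?J = ((1 - s) ^ n / fact n) * indicator {y..1} s"
    proof (cases "s \<in> {y..1}")
      case True
      show ?thesis unfolding J[OF True] using True by simp
    qed auto
  qed
  also have "\<dots> = - ((1 - 1) ^ Suc n / fact (Suc n)) - (- ((1 - y) ^ Suc n / fact (Suc n)))"
  proof (rule integral_FTC_Icc_real)
    fix x assume "y \<le> x" "x \<le> 1"
    have "((\<lambda>s. - ((1 - s) ^ Suc n / fact (Suc n))) has_real_derivative
        - (of_nat (Suc n) * (1 - x) ^ n * (- 1) / fact (Suc n))) (at x)"
      by (auto intro!: derivative_eq_intros simp del: power_Suc of_nat_Suc fact_Suc)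
    moreover have "of_nat (Suc n) / fact (Suc n) = (1 / fact n :: real)" by simp
    ultimately show "((\<lambda>s. - ((1 - s) ^ Suc n / fact (Suc n))) has_real_derivative (1 - x) ^ n / fact n) (at x)"
      by (simp add: field_simps del: power_Suc of_nat_Suc fact_Suc)
    show "isCont (\<lambda>s. (1 - s) ^ n / fact n) x" by (intro continuous_intros) auto
  qed (use Suc in auto)
  finally show ?case by simp
qed

section \<open>Power series on the unit disc\<close>

lemma conv_radius_mono:
  fixes f g :: "nat \<Rightarrow> 'a::{banach, real_normed_div_algebra}"
  assumes "\<And>n. norm (f n) \<le> norm (g n)"
  shows "conv_radius g \<le> conv_radius f"
proof (rule conv_radius_geI_ex')
  fix r :: real assume r: "0 < r" "ereal r < conv_radius g"
  have "summable (\<lambda>n. norm (g n * of_real r ^ n))"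
    by (rule abs_summable_in_conv_radius) (use r in simp)
  then show "summable (\<lambda>n. f n * of_real r ^ n)"
    by (rule summable_comparison_test'[where N = 0])
       (use assms r in \<open>simp add: norm_mult norm_power mult_right_mono\<close>)
qed

lemma fps_conv_radius_integral0:
  fixes f :: "complex fps"
  shows "fps_conv_radius f \<le> fps_conv_radius (fps_integral0 f)"
proof -
  have "norm (inverse (of_nat (Suc n)) * c) \<le> 1 * norm c" for n and c :: complex
    unfolding norm_mult norm_inverse norm_of_nat
    by (rule mult_right_mono) (simp_all add: inverse_le_1_iff)
  then have "fps_conv_radius f \<le> fps_conv_radius (fps_shift 1 (fps_integral0 f))"
    unfolding fps_conv_radius_def by (intro conv_radius_mono) (simp del: of_nat_Suc)
  then show ?thesis by simp
qed

text \<open>This is \<open>(2 \<pi> \<i>)\<^sup>n\<close> times the integral of \<open>R[f\<^sub>1 | \<dots> | f\<^sub>n]\<close> from \<open>\<tau>\<close> to \<open>\<i> \<infinity>\<close>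
  (lemma \<open>integral_R_integrand\<close>). The recursion comes from the first letters of the words in
  \<open>R[f\<^sub>1 | \<dots> | f\<^sub>n]\<close>, which are \<open>f\<^sub>1\<close> and \<open>f\<^sub>n\<^sup>\<infinity>\<close>. The shift divides by \<open>q\<close> a series without
  constant term.\<close>

function reg_primitive :: "'a::field_char_0 fps list \<Rightarrow> 'a fps" where
  "reg_primitive [] = 1"
| "reg_primitive (f # fs) =
     - fps_integral0 (fps_shift 1
         (f * reg_primitive fs - fps_const (fps_nth (last (f # fs)) 0) * reg_primitive (butlast (f # fs))))"
  by pat_completeness auto
termination by (relation "Wellfounded.measure length") auto

lemma reg_primitive_nth_0: "fs \<noteq> [] \<Longrightarrow> fps_nth (reg_primitive fs) 0 = 0"
  by (cases fs) auto

declare reg_primitive.simps(2) [simp del]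

lemma reg_primitive_derivative:
  "fps_X * fps_deriv (reg_primitive (f # fs)) =
     fps_const (fps_nth (last (f # fs)) 0) * reg_primitive (butlast (f # fs)) - f * reg_primitive fs"
proof -
  let ?H = "f * reg_primitive fs - fps_const (fps_nth (last (f # fs)) 0) * reg_primitive (butlast (f # fs))"
  \<comment> \<open>For empty \<open>fs\<close> the series is \<open>f\<close> minus its constant
    term; otherwise both primitives belong to nonempty words and vanish at 0. Hence the shift in the
    recursion loses nothing.\<close>
  have "fps_nth ?H 0 = 0"
    by (cases "fs = []") (auto simp: reg_primitive_nth_0)
  then have "fps_X * fps_shift 1 ?H = ?H"
    by (intro fps_ext) (auto simp: fps_X_mult_nth)
  then show ?thesis
    by (simp add: reg_primitive.simps(2) fps_deriv_fps_integral del: butlast.simps last.simps)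
qed

lemma reg_primitive_conv_radius:
  assumes "\<And>f. f \<in> set fs \<Longrightarrow> fps_conv_radius f \<ge> 1"
  shows "fps_conv_radius (reg_primitive fs :: complex fps) \<ge> 1"
  using assms
proof (induction "length fs" arbitrary: fs rule: less_induct)
  case less
  show ?case
  proof (cases fs)
    case (Cons f gs)
    have "1 \<le> fps_conv_radius f" "1 \<le> fps_conv_radius (reg_primitive gs)"
      using less by (auto simp: Cons)
    moreover have "1 \<le> fps_conv_radius (reg_primitive (butlast fs))"
      by (rule less.hyps) (use less.prems in \<open>auto simp: Cons dest!: in_set_butlastD simp del: butlast.simps\<close>)
    ultimately have
      "1 \<le> fps_conv_radius (f * reg_primitive gs)"
      "1 \<le> fps_conv_radius (fps_const (fps_nth (last fs) 0) * reg_primitive (butlast fs))"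
      using fps_conv_radius_mult[of f "reg_primitive gs"]
        fps_conv_radius_mult[of "fps_const (fps_nth (last fs) 0)" "reg_primitive (butlast fs)"]
      by (auto intro: order_trans simp: min_def split: if_splits)
    then have "1 \<le> fps_conv_radius (f * reg_primitive gs -
        fps_const (fps_nth (last fs) 0) * reg_primitive (butlast fs))"
      by (intro order_trans[OF _ fps_conv_radius_diff]) simp
    then show ?thesis
      unfolding Cons reg_primitive.simps(2)
      by (simp add: order_trans[OF _ fps_conv_radius_integral0] del: butlast.simps last.simps)
  qed simp
qed

lemma eval_fps_bounded:
  fixes f :: "complex fps"
  assumes "ereal \<rho> < fps_conv_radius f"
  obtains C where "C \<ge> 0" "\<And>z. norm z \<le> \<rho> \<Longrightarrow> norm (eval_fps f z) \<le> C"
proof -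
  have "ereal (norm z) < fps_conv_radius f" if "norm z \<le> \<rho>" for z :: complex
    by (rule le_less_trans[OF _ assms]) (use that in simp)
  then have "compact (eval_fps f ` cball 0 \<rho>)"
    by (intro compact_continuous_image continuous_on_subset[OF continuous_on_eval_fps]) auto
  then obtain C where "\<forall>z\<in>cball 0 \<rho>. norm (eval_fps f z) \<le> C"
    by (auto dest!: compact_imp_bounded simp: bounded_iff)
  then have "norm (eval_fps f z) \<le> max 0 C" if "norm z \<le> \<rho>" for z
    using that by (simp add: le_max_iff_disj)
  with max.cobounded1[of 0 C] show thesis by (rule that)
qed

lemma eval_fps_minus_const_bound:
  fixes f :: "complex fps"
  assumes "ereal \<rho> < fps_conv_radius f"
  obtains C where "C \<ge> 0" "\<And>z. norm z \<le> \<rho> \<Longrightarrow> norm (eval_fps f z - fps_nth f 0) \<le> C * norm z"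
proof -
  obtain C where C: "C \<ge> 0" "\<And>z. norm z \<le> \<rho> \<Longrightarrow> norm (eval_fps (fps_shift 1 f) z) \<le> C"
    by (rule eval_fps_bounded[of \<rho> "fps_shift 1 f"]) (use assms in auto)
  have "norm (eval_fps f z - fps_nth f 0) \<le> C * norm z" if z: "norm z \<le> \<rho>" for z
  proof -
    have r: "ereal (norm z) < fps_conv_radius f"
      using z assms by (meson ereal_less_eq(3) le_less_trans)
    have "f = fps_const (fps_nth f 0) + fps_X * fps_shift 1 f"
      by (intro fps_ext) (auto simp: fps_X_mult_nth)
    then have "eval_fps f z = eval_fps (fps_const (fps_nth f 0) + fps_X * fps_shift 1 f) z" by simp
    also have "\<dots> = fps_nth f 0 + z * eval_fps (fps_shift 1 f) z"
      using r by (subst eval_fps_add)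
        (auto simp: eval_fps_mult intro!: less_le_trans[OF _ fps_conv_radius_mult])
    finally show ?thesis
      using mult_left_mono[OF C(2)[OF z], of "norm z"] by (simp add: norm_mult mult.commute)
  qed
  with C(1) show thesis by (rule that)
qed

section \<open>The regularized integral to the cusp\<close>

context
  fixes \<tau> :: complex
  assumes \<tau>: "Im \<tau> > 0"
begin

definition q_at :: "real \<Rightarrow> complex" where
  "q_at t = exp (2 * of_real pi * \<i> * (\<tau> + \<i> * of_real t))"

lemma norm_q_at: "norm (q_at t) = exp (- 2 * pi * Im \<tau>) * exp (- 2 * pi * t)"
  by (simp add: q_at_def norm_exp_eq_Re exp_add[symmetric] algebra_simps)

lemma norm_q_at_le: "t \<ge> 0 \<Longrightarrow> norm (q_at t) \<le> exp (- 2 * pi * Im \<tau>)"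
  unfolding norm_q_at by (rule mult_left_le) auto

lemma norm_q_at_le_exp: "norm (q_at t) \<le> exp (- 2 * pi * t)"
  unfolding norm_q_at by (rule mult_left_le_one_le) (use \<tau> in auto)

lemma radius_less_1: "ereal (exp (- 2 * pi * Im \<tau>)) < 1"
  using \<tau> by simp

text \<open>Only the last variable decays, because \<open>R[f] = f - f\<^sup>\<infinity>\<close> at the end of the recursion; on
  the ordered simplex the last variable dominates the mean of all of them, which gives integrability.\<close>

lemma R_integrand_vertical_bound:
  assumes "\<And>f. f \<in> set fs \<Longrightarrow> fps_conv_radius f \<ge> 1" "fs \<noteq> []"
  shows "\<exists>C\<ge>0. \<forall>t::nat \<Rightarrow> real. (\<forall>j<length fs. t j \<ge> 0) \<longrightarrow>
           norm (R_integrand fs (\<lambda>j. \<tau> + \<i> * t j)) \<le> C * exp (- 2 * pi * t (length fs - 1))"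
  using assms
proof (induction "length fs" arbitrary: fs rule: less_induct)
  case less
  let ?\<rho> = "exp (- 2 * pi * Im \<tau>)"
  obtain f gs where fs: "fs = f # gs" using less.prems(2) by (cases fs) auto
  have f: "ereal ?\<rho> < fps_conv_radius f"
    using less.prems(1)[of f] by (intro less_le_trans[OF radius_less_1]) (simp add: fs)
  show ?case
  proof (cases "gs = []")
    case True
    obtain C where C: "C \<ge> 0" "\<And>z. norm z \<le> ?\<rho> \<Longrightarrow> norm (eval_fps f z - fps_nth f 0) \<le> C * norm z"
      using eval_fps_minus_const_bound[OF f] by blast
    show ?thesis
    proof (intro exI[of _ C] conjI allI impI C(1))
      fix t :: "nat \<Rightarrow> real" assume "\<forall>j<length fs. t j \<ge> 0"
      then have t: "t 0 \<ge> 0" by (simp add: fs)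
      have "norm (R_integrand fs (\<lambda>j. \<tau> + \<i> * t j)) = norm (eval_fps f (q_at (t 0)) - fps_nth f 0)"
        by (simp add: fs True R_integrand_Cons q_at_def)
      also have "\<dots> \<le> C * norm (q_at (t 0))"
        by (rule C(2)[OF norm_q_at_le[OF t]])
      also have "\<dots> \<le> C * exp (- 2 * pi * t 0)"
        by (rule mult_left_mono[OF norm_q_at_le_exp C(1)])
      finally show "norm (R_integrand fs (\<lambda>j. \<tau> + \<i> * t j)) \<le> C * exp (- 2 * pi * t (length fs - 1))"
        by (simp add: fs True)
    qed
  next
    case False
    define c where "c = fps_nth (last fs) 0"
    obtain B where B: "B \<ge> 0" "\<And>z. norm z \<le> ?\<rho> \<Longrightarrow> norm (eval_fps f z) \<le> B"
      using eval_fps_bounded[OF f] by blast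
    have bl: "length (butlast fs) = length gs" "butlast fs \<noteq> []" using False by (auto simp: fs)
    obtain C1 where C1: "C1 \<ge> 0" "\<And>t::nat \<Rightarrow> real. (\<forall>j<length gs. t j \<ge> 0) \<Longrightarrow>
           norm (R_integrand gs (\<lambda>j. \<tau> + \<i> * t j)) \<le> C1 * exp (- 2 * pi * t (length gs - 1))"
      using less.hyps[of gs] less.prems(1) False by (auto simp: fs)
    obtain C2 where C2: "C2 \<ge> 0" "\<And>t::nat \<Rightarrow> real. (\<forall>j<length gs. t j \<ge> 0) \<Longrightarrow>
           norm (R_integrand (butlast fs) (\<lambda>j. \<tau> + \<i> * t j)) \<le> C2 * exp (- 2 * pi * t (length gs - 1))"
    proof -
      have "1 \<le> fps_conv_radius g" if "g \<in> set (butlast fs)" for g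
        using less.prems(1) in_set_butlastD[OF that] .
      moreover have "length (butlast fs) < length fs" by (simp add: fs)
      ultimately have "\<exists>C\<ge>0. \<forall>t::nat \<Rightarrow> real. (\<forall>j<length (butlast fs). t j \<ge> 0) \<longrightarrow>
          norm (R_integrand (butlast fs) (\<lambda>j. \<tau> + \<i> * t j)) \<le> C * exp (- 2 * pi * t (length (butlast fs) - 1))"
        using bl(2) by (intro less.hyps) auto
      then show thesis using that unfolding bl(1) by blast
    qed
    show ?thesis
    proof (intro exI[of _ "B * C1 + norm c * C2"] conjI allI impI)
      show "B * C1 + norm c * C2 \<ge> 0" using B C1 C2 by simp
      fix t :: "nat \<Rightarrow> real" assume t: "\<forall>j<length fs. t j \<ge> 0"
      let ?e = "exp (- 2 * pi * t (length fs - 1))"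
      \<comment> \<open>Both shorter words are read in the variables shifted by one, so the last
        variable of either is the last variable of \<open>fs\<close>; the two induction hypotheses
        give the same exponential.\<close>
      have last: "Suc (length gs - 1) = length fs - 1" using False by (simp add: fs)
      have t': "\<forall>j<length gs. t (Suc j) \<ge> 0" using t by (simp add: fs)
      have "norm (R_integrand fs (\<lambda>j. \<tau> + \<i> * t j)) \<le>
          norm (eval_fps f (q_at (t 0))) * norm (R_integrand gs (\<lambda>j. \<tau> + \<i> * t (Suc j))) +
          norm c * norm (R_integrand (butlast fs) (\<lambda>j. \<tau> + \<i> * t (Suc j)))"
        unfolding fs R_integrand_Cons
        by (rule order_trans[OF norm_triangle_ineq4])
           (simp add: q_at_def norm_mult c_def fs o_def del: butlast.simps last.simps)
      also have "\<dots> \<le> B * (C1 * ?e) + norm c * (C2 * ?e)"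
        using B(2)[OF norm_q_at_le, of "t 0"] t C1(2)[OF t'] C2(2)[OF t'] B(1)
        unfolding last by (intro add_mono mult_mono) (auto simp: fs)
      finally show "norm (R_integrand fs (\<lambda>j. \<tau> + \<i> * t j)) \<le> (B * C1 + norm c * C2) * ?e"
        by (simp add: algebra_simps)
    qed
  qed
qed

lemma borel_measurable_eval_fps_q_at [measurable]:
  "(\<lambda>s. eval_fps f (q_at s)) \<in> borel_measurable borel"
  unfolding eval_fps_def q_at_def by measurable

lemma measurable_R_integrand:
  "length fs = n \<Longrightarrow>
     (\<lambda>t. R_integrand fs (\<lambda>j. \<tau> + \<i> * of_real (t (a + j)))) \<in> borel_measurable (lborel_pow {a..<a + n})"
proof -
  assume n: "length fs = n"
  have factor: "(\<lambda>t. eval_fps g (exp (2 * of_real pi * \<i> * (\<tau> + \<i> * of_real (t (a + j))))))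
      \<in> borel_measurable (lborel_pow {a..<a + n})" if "j < n" for g j
  proof -
    have "(\<lambda>t. t (a + j)) \<in> borel_measurable (lborel_pow {a..<a + n})"
      using measurable_component_singleton[of "a + j" "{a..<a + n}" "\<lambda>_. lborel"] that by simp
    from measurable_compose[OF this borel_measurable_eval_fps_q_at] show ?thesis
      by (simp add: q_at_def)
  qed
  show ?thesis
    unfolding R_integrand_def shuffle_integrand_def word_integrand_def Let_def
    by (intro borel_measurable_sum borel_measurable_times borel_measurable_const borel_measurable_prod factor)
       (use n in auto)
qed


lemma integrable_R_integrand:
  assumes fs: "\<And>f. f \<in> set fs \<Longrightarrow> fps_conv_radius f \<ge> 1" and n: "length fs = n" and y: "0 \<le> y"
  shows "integrable (lborel_pow {a..<a + n})
    (\<lambda>t. indicator (ordered_simplex UNIV a n y) t *\<^sub>R R_integrand fs (\<lambda>j. \<tau> + \<i> * of_real (t (a + j))))"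
proof (cases "n = 0")
  case True
  then show ?thesis
    using integrable_ordered_simplex[of UNIV "\<lambda>_. 1 :: complex" a 0 "\<lambda>_. 0" y 1] n by simp
next
  case False
  \<comment> \<open>The exponential of the last variable is at most that of the mean of all
    \<open>n\<close> variables, which is a product of \<open>n\<close> exponentials of rate
    \<open>2 * pi / n\<close>.\<close>
  define g where "g = (\<lambda>s. indicator {0..} s *\<^sub>R exp (- (2 * pi / n) * s))"
  obtain C where C: "C \<ge> 0" "\<And>t::nat \<Rightarrow> real. (\<forall>j<n. t j \<ge> 0) \<Longrightarrow>
      norm (R_integrand fs (\<lambda>j. \<tau> + \<i> * t j)) \<le> C * exp (- 2 * pi * t (n - 1))"
    using R_integrand_vertical_bound[OF fs] False n by fastforce
  show ?thesis
  proof (rule integrable_ordered_simplex)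
    define k where "k = 2 * pi / n"
    have k: "k > 0" using False by (simp add: k_def)
    have "(\<integral>\<^sup>+s. ennreal (exp (- k * s)) * indicator {0..} s \<partial>lborel) = ennreal (0 - (- exp (- k * 0) / k))"
    proof (rule nn_integral_FTC_atLeast)
      show "((\<lambda>s. - exp (- k * s) / k) \<longlongrightarrow> 0) at_top"
        using k by real_asymp
    qed (use k in \<open>auto intro!: derivative_eq_intros\<close>)
    also have "(\<integral>\<^sup>+s. ennreal (exp (- k * s)) * indicator {0..} s \<partial>lborel) = (\<integral>\<^sup>+s. ennreal (g s) \<partial>lborel)"
      by (rule nn_integral_cong) (simp add: g_def k_def indicator_def)
    finally show "integrable lborel g"
      by (intro integrableI_nonneg) (auto simp: g_def)
    show "(\<lambda>t. R_integrand fs (\<lambda>j. \<tau> + \<i> * of_real (t (a + j)))) \<in> borel_measurable (lborel_pow {a..<a + n})"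
      by (rule measurable_R_integrand[OF n])
    fix t assume t: "t \<in> ordered_simplex UNIV a n y"
    let ?I = "{a..<a + n}"
    have nonneg: "t j \<ge> 0" if "j \<in> ?I" for j
    proof -
      have "y \<le> t j" using t that by (simp add: ordered_simplex_def)
      with y show ?thesis by simp
    qed
    have le: "t j \<le> t (a + (n - 1))" if "j \<in> ?I" for j
      using t that False unfolding ordered_simplex_def by (auto intro: mono_onD)
    have "(\<Sum>j\<in>?I. t j) \<le> (\<Sum>j\<in>?I. t (a + (n - 1)))" by (rule sum_mono) (rule le)
    then have "(\<Sum>j\<in>?I. t j) / n \<le> t (a + (n - 1))" using False by (simp add: field_simps)
    then have "exp (- 2 * pi * t (a + (n - 1))) \<le> exp (- 2 * pi * ((\<Sum>j\<in>?I. t j) / n))"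
      unfolding exp_le_cancel_iff by (rule mult_left_mono_neg) simp
    also have "- 2 * pi * ((\<Sum>j\<in>?I. t j) / n) = (\<Sum>j\<in>?I. - (2 * pi / n) * t j)"
      by (simp add: sum_distrib_left sum_divide_distrib sum_negf)
    also have "exp \<dots> = (\<Prod>j\<in>?I. g (t j))"
      unfolding exp_sum[OF finite_atLeastLessThan] by (rule prod.cong) (use nonneg in \<open>auto simp: g_def\<close>)
    finally have "exp (- 2 * pi * t (a + (n - 1))) \<le> (\<Prod>j\<in>?I. g (t j))" .
    with C(2)[of "\<lambda>j. t (a + j)"] C(1) nonneg
    show "norm (R_integrand fs (\<lambda>j. \<tau> + \<i> * of_real (t (a + j)))) \<le> C * (\<Prod>j\<in>?I. g (t j))"
      by (intro order_trans[OF C(2)] mult_left_mono) auto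
  qed (auto simp: g_def C)
qed

lemma norm_q_at_less_1: "s \<ge> 0 \<Longrightarrow> norm (q_at s) < 1"
  using norm_q_at_le[of s] radius_less_1 by (simp del: exp_less_one_iff exp_le_one_iff)

lemma norm_q_at_less_conv_radius:
  "s \<ge> 0 \<Longrightarrow> 1 \<le> fps_conv_radius f \<Longrightarrow> ereal (norm (q_at s)) < fps_conv_radius f"
  using norm_q_at_less_1[of s] by (metis ereal_less(3) less_le_trans ereal_less_eq(3) one_ereal_def less_ereal.simps(1))

lemma q_at_derivative: "(q_at has_vector_derivative (- 2 * pi * q_at s)) (at s)"
proof -
  have "((\<lambda>w. exp (2 * of_real pi * \<i> * (\<tau> + \<i> * w))) has_field_derivative - 2 * pi * q_at s) (at (of_real s))"
  proof -
    have "((\<lambda>w. 2 * of_real pi * \<i> * (\<tau> + \<i> * w)) has_field_derivative 2 * of_real pi * \<i> * (0 + \<i> * 1)) (at (of_real s))"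
      by (intro DERIV_cmult DERIV_add DERIV_const DERIV_ident)
    from DERIV_fun_exp[OF this] show ?thesis
      by (simp add: q_at_def mult_ac)
  qed
  from has_vector_derivative_real_field[OF this] show ?thesis
    unfolding q_at_def[abs_def] .
qed

lemma tendsto_q_at: "(q_at \<longlongrightarrow> 0) at_top"
proof (rule Lim_null_comparison)
  show "((\<lambda>t. exp (- 2 * pi * t)) \<longlongrightarrow> 0) at_top" by real_asymp
qed (use norm_q_at_le_exp in auto)

lemma continuous_on_eval_fps_q_at:
  assumes "1 \<le> fps_conv_radius f"
  shows "continuous_on {0..} (\<lambda>s. eval_fps f (q_at s))"
  by (rule continuous_on_eval_fps')
     (use norm_q_at_less_conv_radius[OF _ assms] in \<open>auto simp: q_at_def intro!: continuous_intros\<close>)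

text \<open>Along the vertical line d/ds equals -2 pi q d/dq, so this is
  \<open>reg_primitive_derivative\<close> multiplied by -2 pi.\<close>

lemma reg_primitive_vertical_derivative:
  assumes fs: "\<And>g. g \<in> set (f # fs) \<Longrightarrow> fps_conv_radius g \<ge> 1" and s: "0 \<le> s"
  shows "((\<lambda>s. eval_fps (reg_primitive (f # fs)) (q_at s)) has_vector_derivative
    (2 * pi) * (eval_fps f (q_at s) * eval_fps (reg_primitive fs) (q_at s) -
       fps_nth (last (f # fs)) 0 * eval_fps (reg_primitive (butlast (f # fs))) (q_at s))) (at s)"
proof -
  define P where "P = reg_primitive (f # fs)"
  define A where "A = reg_primitive fs"
  define B where "B = reg_primitive (butlast (f # fs))"
  define c where "c = fps_nth (last (f # fs)) 0"
  define q where "q = q_at s"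
  have radius: "1 \<le> fps_conv_radius P" "1 \<le> fps_conv_radius A" "1 \<le> fps_conv_radius B" "1 \<le> fps_conv_radius f"
    unfolding P_def A_def B_def using fs by (auto intro!: reg_primitive_conv_radius dest: in_set_butlastD simp del: butlast.simps)
  note less = norm_q_at_less_conv_radius[OF s, folded q_def]
  have "1 \<le> fps_conv_radius (f * A)" "1 \<le> fps_conv_radius (fps_const c * B)"
    using order_trans[OF _ fps_conv_radius_mult[of f A]] order_trans[OF _ fps_conv_radius_mult[of "fps_const c" B]]
      radius by auto
  moreover have "1 \<le> fps_conv_radius (fps_deriv P)"
    using radius(1) fps_conv_radius_deriv[of P] by (rule order_trans)
  ultimately have eq: "q * eval_fps (fps_deriv P) q = c * eval_fps B q - eval_fps f q * eval_fps A q"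
    using arg_cong[OF reg_primitive_derivative[of f fs, folded P_def A_def B_def c_def], of "\<lambda>h. eval_fps h q"]
      radius[THEN less] less[of "f * A"] less[of "fps_const c * B"] less[of "fps_deriv P"]
    by (simp add: eval_fps_mult eval_fps_diff)
  have "(- 2 * pi * q) * eval_fps (fps_deriv P) q = 2 * pi * (eval_fps f q * eval_fps A q - c * eval_fps B q)"
    unfolding mult.assoc eq by (simp add: algebra_simps)
  moreover have "((eval_fps P \<circ> q_at) has_vector_derivative (- 2 * pi * q) * eval_fps (fps_deriv P) q) (at s)"
    unfolding q_def
    by (intro field_vector_diff_chain_at q_at_derivative has_field_derivative_eval_fps
        norm_q_at_less_conv_radius s radius)
  ultimately show ?thesis
    unfolding P_def[symmetric] A_def[symmetric] B_def[symmetric] c_def[symmetric] q_def[symmetric]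
    by (simp only: o_def)
qed

text \<open>Induction on the length: the first variable is split off,
  \<open>R_integrand_Cons\<close> reduces the inner integral to shorter words, and the outer
  integrand is then minus the derivative of the claimed value. The lower end \<open>y\<close> is
  arbitrary because the inner integrals start at \<open>s\<close>.\<close>

lemma integral_R_integrand:
  assumes fs: "\<And>f. f \<in> set fs \<Longrightarrow> fps_conv_radius f \<ge> 1" and n: "length fs = n" and y: "0 \<le> y"
  shows "(- 2 * pi) ^ n * (\<integral>t. indicator (ordered_simplex UNIV a n y) t *\<^sub>R
        R_integrand fs (\<lambda>j. \<tau> + \<i> * of_real (t (a + j))) \<partial>lborel_pow {a..<a + n}) =
     eval_fps (reg_primitive fs) (q_at y)"
  using assms
proof (induction n arbitrary: fs a y)
  case 0
  then show ?case by (simp add: PiM_empty lebesgue_integral_count_space_finite)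
next
  case (Suc n)
  then obtain f gs where eq: "fs = f # gs" and len: "length gs = n" by (cases fs) auto
  define c where "c = fps_nth (last fs) 0"
  define bs where "bs = butlast fs"
  have bs: "length bs = n" "\<And>f. f \<in> set bs \<Longrightarrow> fps_conv_radius f \<ge> 1"
    using Suc.prems by (auto simp: bs_def dest: in_set_butlastD)
  have gs: "\<And>f. f \<in> set gs \<Longrightarrow> fps_conv_radius f \<ge> 1"
    using Suc.prems(1) by (auto simp: eq)
  let ?R = "\<lambda>fs a t. R_integrand fs (\<lambda>j. \<tau> + \<i> * of_real (t (a + j)))"
  let ?\<chi> = "\<lambda>a n s t. indicator (ordered_simplex UNIV a n s) t"
  define F where "F = (\<lambda>s. eval_fps (reg_primitive fs) (q_at s))"
  define F' where "F' = (\<lambda>s. eval_fps f (q_at s) * eval_fps (reg_primitive gs) (q_at s) -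
     c * eval_fps (reg_primitive bs) (q_at s))"
  have inner: "(- 2 * pi) ^ Suc n * (\<integral>t. ?\<chi> (Suc a) n s t *\<^sub>R ?R fs a (t(a := s)) \<partial>lborel_pow {Suc a..<Suc a + n}) =
      - (2 * pi * F' s)" if s: "0 \<le> s" for s
  proof -
    let ?M = "lborel_pow {Suc a..<Suc a + n}"
    let ?A = "\<integral>t. ?\<chi> (Suc a) n s t *\<^sub>R ?R gs (Suc a) t \<partial>?M"
    let ?B = "\<integral>t. ?\<chi> (Suc a) n s t *\<^sub>R ?R bs (Suc a) t \<partial>?M"
    have "(\<lambda>t. ?\<chi> (Suc a) n s t *\<^sub>R ?R fs a (t(a := s))) =
        (\<lambda>t. eval_fps f (q_at s) * (?\<chi> (Suc a) n s t *\<^sub>R ?R gs (Suc a) t) -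
              c * (?\<chi> (Suc a) n s t *\<^sub>R ?R bs (Suc a) t))"
      by (simp add: eq R_integrand_Cons bs_def c_def q_at_def o_def fun_eq_iff scaleR_conv_of_real
          algebra_simps del: butlast.simps last.simps)
    then have "(\<integral>t. ?\<chi> (Suc a) n s t *\<^sub>R ?R fs a (t(a := s)) \<partial>?M) = eval_fps f (q_at s) * ?A - c * ?B"
      using integrable_R_integrand[OF gs len s, of "Suc a"] integrable_R_integrand[OF bs(2,1) s, of "Suc a"]
      by (simp only: Bochner_Integration.integral_diff integrable_mult_right integral_mult_right_zero)
    moreover have "(- 2 * pi) ^ n * ?A = eval_fps (reg_primitive gs) (q_at s)"
      by (rule Suc.IH[OF gs len s])
    moreover have "(- 2 * pi) ^ n * ?B = eval_fps (reg_primitive bs) (q_at s)"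
      by (rule Suc.IH[OF bs(2,1) s])
    moreover define IA IB where "IA = ?A" "IB = ?B"
    ultimately have I: "(\<integral>t. ?\<chi> (Suc a) n s t *\<^sub>R ?R fs a (t(a := s)) \<partial>?M) = eval_fps f (q_at s) * IA - c * IB"
      and A: "(- 2 * pi) ^ n * IA = eval_fps (reg_primitive gs) (q_at s)"
      and B: "(- 2 * pi) ^ n * IB = eval_fps (reg_primitive bs) (q_at s)"
      by simp_all
    have "(- 2 * pi) ^ Suc n * (eval_fps f (q_at s) * IA - c * IB) =
        - (2 * pi * (eval_fps f (q_at s) * ((- 2 * pi) ^ n * IA) - c * ((- 2 * pi) ^ n * IB)))"
      by (simp add: algebra_simps)
    then show ?thesis unfolding I A B F'_def .
  qed
  have int: "integrable (lborel_pow {a..<a + Suc n}) (\<lambda>t. ?\<chi> a (Suc n) y t *\<^sub>R ?R fs a t)"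
    by (rule integrable_R_integrand[OF Suc.prems])
  have outer: "(- 2 * pi) ^ Suc n * (indicator (UNIV \<inter> {y..}) s *\<^sub>R
      (\<integral>t. ?\<chi> (Suc a) n s t *\<^sub>R ?R fs a (t(a := s)) \<partial>lborel_pow {Suc a..<Suc a + n})) =
      indicator {y..} s *\<^sub>R (- (2 * pi * F' s))" for s
    using inner[of s] Suc.prems(3) by (auto simp: indicator_def)
  have int': "set_integrable lborel {y..} (\<lambda>s. - (2 * pi * F' s))"
    using integrable_mult_right[OF integral_ordered_simplex_Suc(2)[OF int], of "(- 2 * pi) ^ Suc n"]
    unfolding outer set_integrable_def .
  have "(- 2 * pi) ^ Suc n * (\<integral>t. ?\<chi> a (Suc n) y t *\<^sub>R ?R fs a t \<partial>lborel_pow {a..<a + Suc n}) =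
      (LINT s:{y..}|lborel. - (2 * pi * F' s))"
    unfolding integral_ordered_simplex_Suc(1)[OF int] set_lebesgue_integral_def outer[symmetric]
    by (rule integral_mult_right_zero[symmetric])
  also have "\<dots> = F y"
  proof (rule tendsto_unique[of at_top])
    show "((\<lambda>b. LINT s:{y..b}|lborel. - (2 * pi * F' s)) \<longlongrightarrow> (LINT s:{y..}|lborel. - (2 * pi * F' s))) at_top"
      by (rule tendsto_set_lebesgue_integral_at_top[OF _ int']) simp
    have radius: "1 \<le> fps_conv_radius f" "1 \<le> fps_conv_radius (reg_primitive gs)"
        "1 \<le> fps_conv_radius (reg_primitive bs)" "1 \<le> fps_conv_radius (reg_primitive fs)"
      using gs bs(2) Suc.prems(1) by (auto intro!: reg_primitive_conv_radius simp: eq)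
    \<comment> \<open>No boundary term arises at infinity: q tends to 0 there, and the primitive of
      a nonempty word has no constant term.\<close>
    have "isCont (eval_fps (reg_primitive fs)) 0"
      by (rule continuous_eval_fps) (use radius(4) in \<open>auto intro: less_le_trans[of _ 1]\<close>)
    from isCont_tendsto_compose[OF this tendsto_q_at] have "(F \<longlongrightarrow> 0) at_top"
      using Suc.prems(2) by (simp add: F_def eval_fps_at_0 reg_primitive_nth_0 eq)
    then have "((\<lambda>b. - F b - (- F y)) \<longlongrightarrow> - 0 - (- F y)) at_top"
      by (intro tendsto_intros)
    moreover have "eventually (\<lambda>b. - F b - (- F y) = (LINT s:{y..b}|lborel. - (2 * pi * F' s))) at_top"
      using eventually_ge_at_top[of y]
    proof eventually_elim
      case (elim b)
      show ?case
        unfolding set_lebesgue_integral_def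
      proof (rule integral_FTC_atLeastAtMost[symmetric, OF elim])
        fix x assume x: "y \<le> x" "x \<le> b"
        have "(F has_vector_derivative 2 * pi * F' x) (at x)"
          unfolding F_def F'_def c_def bs_def eq
          by (rule reg_primitive_vertical_derivative) (use Suc.prems x in \<open>auto simp: eq\<close>)
        then show "((\<lambda>b. - F b) has_vector_derivative - (2 * pi * F' x)) (at x within {y..b})"
          by (rule has_vector_derivative_at_within[OF has_vector_derivative_minus])
      next
        have "continuous_on {0..} (\<lambda>s. - (2 * pi * F' s))"
          unfolding F'_def by (intro continuous_intros continuous_on_eval_fps_q_at radius)
        then show "continuous_on {y..b} (\<lambda>s. - (2 * pi * F' s))"
          by (rule continuous_on_subset) (use Suc.prems(3) in auto)
      qed
    qed
    ultimately show "((\<lambda>b. LINT s:{y..b}|lborel. - (2 * pi * F' s)) \<longlongrightarrow> F y) at_top"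
      by (simp add: Lim_transform_eventually)
  qed simp
  finally show ?case by (simp only: F_def)
qed

end

section \<open>Expansions of regularized integrals\<close>

text \<open>Each variable contributes the derivative \<i> of the path, and 2 pi \<i> times \<i> is
  the factor -2 pi of \<open>integral_R_integrand\<close>.\<close>

lemma iterated_integral_vertical:
  assumes "\<And>f. f \<in> set fs \<Longrightarrow> fps_conv_radius f \<ge> 1" "Im \<tau> > 0"
  shows "(2 * of_real pi * \<i>) ^ length fs *
      iterated_integral (\<lambda>t. \<tau> + \<i> * of_real t) {0..} (length fs) (R_integrand fs) =
    eval_fps (reg_primitive fs) (exp (2 * of_real pi * \<i> * \<tau>))"
proof -
  let ?n = "length fs"
  have "((\<lambda>t. \<tau> + \<i> * of_real t) has_vector_derivative \<i>) (at s)" for s :: real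
    by (auto intro!: derivative_eq_intros has_vector_derivative_real_field[of "\<lambda>w. \<tau> + \<i> * w"])
  then have deriv: "vector_derivative (\<lambda>t. \<tau> + \<i> * of_real t) (at s) = \<i>" for s :: real
    by (rule vector_derivative_at)
  \<comment> \<open>The lower end of the parameter range is carried by \<open>y = 0\<close>, so only
    an upper end would have to appear in \<open>U\<close>; for a segment it becomes
    \<open>{..1}\<close>.\<close>
  have A: "{t. t ` {..<?n} \<subseteq> {0..} \<and> mono_on {..<?n} t} = ordered_simplex UNIV 0 ?n (0::real)"
    by (auto simp: ordered_simplex_def lessThan_atLeast0)
  have "iterated_integral (\<lambda>t. \<tau> + \<i> * of_real t) {0..} ?n (R_integrand fs) =
      (\<integral>t. (indicator (ordered_simplex UNIV 0 ?n 0) t *\<^sub>R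
        R_integrand fs (\<lambda>j. \<tau> + \<i> * of_real (t (0 + j)))) * \<i> ^ ?n \<partial>lborel_pow {0..<0 + ?n})"
    unfolding iterated_integral_def set_lebesgue_integral_def A deriv
    by (simp add: lessThan_atLeast0)
  also have "\<dots> = (\<integral>t. indicator (ordered_simplex UNIV 0 ?n 0) t *\<^sub>R
        R_integrand fs (\<lambda>j. \<tau> + \<i> * of_real (t (0 + j))) \<partial>lborel_pow {0..<0 + ?n}) * \<i> ^ ?n"
    by (rule integral_mult_left_zero)
  finally have eq: "iterated_integral (\<lambda>t. \<tau> + \<i> * of_real t) {0..} ?n (R_integrand fs) = \<dots>" .
  have "(2 * of_real pi * \<i>) ^ ?n * \<i> ^ ?n = (- 2 * of_real pi :: complex) ^ ?n"
    unfolding power_mult_distrib[symmetric] by (simp add: mult.assoc)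
  then have scale: "(2 * of_real pi * \<i>) ^ ?n * (X * \<i> ^ ?n) = (- 2 * of_real pi) ^ ?n * X" for X :: complex
    by (metis mult.assoc mult.commute)
  show ?thesis
    unfolding eq scale using integral_R_integrand[OF assms(2,1) refl order_refl, of fs 0]
    by (simp add: q_at_def[OF assms(2)])
qed

text \<open>The integrand is constant, so only the simplex volume
  \<open>1 / fact (length fs)\<close> matters. The segment has derivative \<open>- \<tau>\<close>,
  which turns each factor 2 pi \<i> into minus log q.\<close>

lemma iterated_integral_const:
  "(2 * of_real pi * \<i>) ^ length fs *
      iterated_integral (linepath \<tau> 0) {0..1} (length fs) (word_integrand (map const_part fs)) =
    (\<Prod>f\<leftarrow>fs. fps_nth f 0) * (- 1) ^ length fs / fact (length fs) * (2 * of_real pi * \<i> * \<tau>) ^ length fs"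
proof -
  let ?n = "length fs"
  have deriv: "vector_derivative (linepath \<tau> 0) (at s) = - \<tau>" for s :: real
    using vector_derivative_at[OF has_vector_derivative_linepath_within] by simp
  have A: "{t. t ` {..<?n} \<subseteq> {0..1} \<and> mono_on {..<?n} t} = ordered_simplex {..1} 0 ?n (0::real)"
    by (auto simp: ordered_simplex_def lessThan_atLeast0)
  have word: "word_integrand (map const_part fs) z = (\<Prod>f\<leftarrow>fs. fps_nth f 0)" for z
    by (induction fs arbitrary: z) (simp_all add: word_integrand_Cons const_part_def)
  have "iterated_integral (linepath \<tau> 0) {0..1} ?n (word_integrand (map const_part fs)) =
      (\<integral>t. of_real (indicator (ordered_simplex {..1} 0 ?n 0) t) * ((\<Prod>f\<leftarrow>fs. fps_nth f 0) * (- \<tau>) ^ ?n)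
        \<partial>lborel_pow {0..<0 + ?n})"
    unfolding iterated_integral_def set_lebesgue_integral_def A deriv word
    by (simp add: lessThan_atLeast0 scaleR_conv_of_real)
  also have "\<dots> = of_real (\<integral>t. indicator (ordered_simplex {..1} 0 ?n 0) t \<partial>lborel_pow {0..<0 + ?n}) *
      ((\<Prod>f\<leftarrow>fs. fps_nth f 0) * (- \<tau>) ^ ?n)"
    by (simp only: integral_mult_left_zero integral_complex_of_real)
  also have "\<dots> = (\<Prod>f\<leftarrow>fs. fps_nth f 0) * (- \<tau>) ^ ?n / fact ?n"
    unfolding integral_ordered_simplex_unit[OF order_refl zero_le_one] by simp
  finally show ?thesis
    by (simp add: power_mult_distrib power_minus[of \<tau>])
qed

theorem regularized_integral_eq:
  assumes "\<And>f. f \<in> set fs \<Longrightarrow> fps_conv_radius f \<ge> 1" "Im \<tau> > 0"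
  shows "regularized_integral fs \<tau> =
    (\<Sum>i\<le>length fs. eval_fps (reg_primitive (take i fs)) (exp (2 * of_real pi * \<i> * \<tau>)) *
       ((\<Prod>f\<leftarrow>drop i fs. fps_nth f 0) * (- 1) ^ (length fs - i) / fact (length fs - i) *
         (2 * of_real pi * \<i> * \<tau>) ^ (length fs - i)))"
  unfolding regularized_integral_def sum_distrib_left
proof (rule sum.cong[OF refl])
  fix i assume "i \<in> {..length fs}"
  then have i: "length (take i fs) = i" "i \<le> length fs" by auto
  let ?A = "iterated_integral (\<lambda>t. \<tau> + \<i> * of_real t) {0..} i (R_integrand (take i fs))"
  let ?B = "iterated_integral (linepath \<tau> 0) {0..1} (length fs - i) (word_integrand (map const_part (drop i fs)))"
  let ?w = "2 * of_real pi * \<i> :: complex"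
  have "?w ^ length fs * (?A * ?B) = (?w ^ i * ?A) * (?w ^ (length fs - i) * ?B)"
    using i(2) by (simp add: mult_ac flip: power_add)
  also have "?w ^ i * ?A = eval_fps (reg_primitive (take i fs)) (exp (?w * \<tau>))"
    using iterated_integral_vertical[of "take i fs", OF _ assms(2), unfolded i(1)] assms(1)
    by (meson in_set_takeD)
  also have "?w ^ (length fs - i) * ?B = (\<Prod>f\<leftarrow>drop i fs. fps_nth f 0) * (- 1) ^ (length fs - i) /
      fact (length fs - i) * (?w * \<tau>) ^ (length fs - i)"
    using iterated_integral_const[of "drop i fs" \<tau>] by simp
  finally show "?w ^ length fs * (?A * ?B) = eval_fps (reg_primitive (take i fs)) (exp (?w * \<tau>)) *
      ((\<Prod>f\<leftarrow>drop i fs. fps_nth f 0) * (- 1) ^ (length fs - i) / fact (length fs - i) *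
         (?w * \<tau>) ^ (length fs - i))" .
qed

text \<open>The expansion must have rational coefficients while the integrals evaluate complex
  series; hence a rational copy of \<open>eisenstein\<close>, sent back by
  \<open>complex_fps_of_rat\<close>.\<close>

definition eisenstein_rat :: "nat \<Rightarrow> rat fps" where
  "eisenstein_rat k =
     (if k = 0 then - 1
      else Abs_fps (\<lambda>n. if n = 0 then - bernoulli_num (2 * k) / (4 * of_nat k)
                        else (\<Sum>d | d dvd n. of_nat d ^ (2 * k - 1))))"

definition complex_fps_of_rat :: "rat fps \<Rightarrow> complex fps" where
  "complex_fps_of_rat f = Abs_fps (\<lambda>n. of_rat (fps_nth f n))"

lemma complex_fps_of_rat_nth [simp]: "fps_nth (complex_fps_of_rat f) n = of_rat (fps_nth f n)"
  by (simp add: complex_fps_of_rat_def)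

lemma complex_fps_of_rat_eisenstein: "complex_fps_of_rat (eisenstein_rat k) = eisenstein k"
  by (rule fps_ext)
     (simp add: eisenstein_rat_def eisenstein_def of_rat_sum of_rat_power of_rat_divide of_rat_minus of_rat_mult)

text \<open>The recursion uses only field operations on coefficients, so it commutes with the
  embedding of the rationals.\<close>

lemma complex_fps_of_rat_reg_primitive:
  "complex_fps_of_rat (reg_primitive fs) = reg_primitive (map complex_fps_of_rat fs)"
proof (induction fs rule: reg_primitive.induct)
  case (2 f fs)
  have "complex_fps_of_rat (reg_primitive (f # fs)) = - fps_integral0 (fps_shift 1
      (complex_fps_of_rat f * complex_fps_of_rat (reg_primitive fs) -
       fps_const (fps_nth (complex_fps_of_rat (last (f # fs))) 0) * complex_fps_of_rat (reg_primitive (butlast (f # fs)))))"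
    (is "_ = ?r")
  proof (rule fps_ext)
    fix n show "fps_nth (complex_fps_of_rat (reg_primitive (f # fs))) n = fps_nth ?r n"
      by (cases n) (simp_all add: reg_primitive.simps(2) fps_mult_nth of_rat_sum of_rat_mult of_rat_diff
          of_rat_minus of_rat_inverse of_rat_add if_distrib[of of_rat] cong: if_cong del: butlast.simps last.simps of_nat_Suc)
  qed
  also have "\<dots> = reg_primitive (map complex_fps_of_rat (f # fs))"
    using 2 by (simp add: reg_primitive.simps(2) last_map map_butlast)
  finally show ?case .
qed (simp add: fps_eq_iff)

text \<open>For n > 0 the coefficient is a sum of at most n terms, each at most n^(2k-1). The bound
  n^(2k) has radius 1 by the ratio test; the shift sets the Bernoulli constant aside.\<close>

lemma eisenstein_conv_radius: "fps_conv_radius (eisenstein k) \<ge> 1"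
proof (cases "k = 0")
  case True
  then show ?thesis by (simp add: eisenstein_def)
next
  case False
  have "conv_radius (\<lambda>n. of_nat (Suc n) ^ (2 * k) :: complex) = 1"
  proof (rule conv_radius_ratio_limit[of 1, simplified])
    have "(\<lambda>n. (real (Suc n) / real (Suc (Suc n))) ^ (2 * k)) \<longlonglongrightarrow> 1 ^ (2 * k)"
      by (intro tendsto_power LIMSEQ_Suc[OF LIMSEQ_n_over_Suc_n])
    then show "(\<lambda>n. norm (of_nat (Suc n) ^ (2 * k) :: complex) / norm (of_nat (Suc (Suc n)) ^ (2 * k) :: complex))
        \<longlonglongrightarrow> 1"
      by (simp only: norm_power norm_of_nat power_divide power_one)
  qed (simp_all add: one_ereal_def del: of_nat_Suc)
  moreover have "conv_radius (\<lambda>n. of_nat (Suc n) ^ (2 * k) :: complex) \<le>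
      conv_radius (fps_nth (fps_shift 1 (eisenstein k)))"
  proof (rule conv_radius_mono)
    fix n
    have "norm (fps_nth (fps_shift 1 (eisenstein k)) n) = norm (\<Sum>d | d dvd Suc n. of_nat d ^ (2 * k - 1) :: complex)"
      using False by (simp add: eisenstein_def)
    also have "\<dots> \<le> (\<Sum>d | d dvd Suc n. real (Suc n) ^ (2 * k - 1))"
      by (rule sum_norm_le) (auto simp: norm_power dest!: dvd_imp_le intro!: power_mono simp del: of_nat_Suc)
    also have "\<dots> = real (card {d. d dvd Suc n}) * real (Suc n) ^ (2 * k - 1)"
      by simp
    also have "\<dots> \<le> real (Suc n) * real (Suc n) ^ (2 * k - 1)"
    proof (rule mult_right_mono)
      have "card {d. d dvd Suc n} \<le> card {1..Suc n}"
      proof (rule card_mono)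
        show "{d. d dvd Suc n} \<subseteq> {1..Suc n}"
        proof
          fix d assume "d \<in> {d. d dvd Suc n}"
          then have "d dvd Suc n" by simp
          from dvd_imp_le[OF this] dvd_pos_nat[OF _ this] show "d \<in> {1..Suc n}" by simp
        qed
      qed simp
      then show "real (card {d. d dvd Suc n}) \<le> real (Suc n)" by simp
    qed simp
    also have "\<dots> = real (Suc n) ^ (2 * k)"
      using False by (cases k) simp_all
    finally show "norm (fps_nth (fps_shift 1 (eisenstein k)) n) \<le> norm (of_nat (Suc n) ^ (2 * k) :: complex)"
      by (simp only: norm_power norm_of_nat)
  qed
  ultimately have "1 \<le> fps_conv_radius (fps_shift 1 (eisenstein k))"
    by (simp only: fps_conv_radius_def)
  then show ?thesis by simp
qed

text \<open>The coefficient of the power of log q in \<open>iterated_integral_const\<close>.\<close>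

definition log_coeff :: "rat fps list \<Rightarrow> rat" where
  "log_coeff fs = (\<Prod>f\<leftarrow>fs. fps_nth f 0) * (- 1) ^ length fs / fact (length fs)"

definition qlog_expansion :: "rat fps list \<Rightarrow> rat poly fls" where
  "qlog_expansion fs =
     (\<Sum>i\<le>length fs. fls_const_coeffs (fps_to_fls (reg_primitive (take i fs))) *
        fls_const (monom (log_coeff (drop i fs)) (length fs - i)))"

lemma poly_map_of_rat_add:
  "poly (map_poly of_rat (p + r)) x = poly (map_poly of_rat p) x + (poly (map_poly of_rat r) x :: complex)"
proof -
  have "map_poly of_rat (p + r) = map_poly of_rat p + (map_poly of_rat r :: complex poly)"
    by (rule poly_eqI) (simp add: coeff_map_poly of_rat_add)
  then show ?thesis by simp
qed

lemma fls_nth_sum: "fls_nth (\<Sum>i\<in>A. f i) n = (\<Sum>i\<in>A. fls_nth (f i) n)"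
  by (induction A rule: infinite_finite_induct) auto

lemma poly_map_of_rat_sum:
  "poly (map_poly of_rat (\<Sum>i\<in>A. p i)) x = (\<Sum>i\<in>A. poly (map_poly of_rat (p i)) x :: complex)"
  by (induction A rule: infinite_finite_induct) (auto simp: poly_map_of_rat_add)

lemma has_sum_sum:
  fixes f :: "'i \<Rightarrow> 'a \<Rightarrow> complex"
  assumes "\<And>i. i \<in> I \<Longrightarrow> (f i has_sum s i) A"
  shows "((\<lambda>x. \<Sum>i\<in>I. f i x) has_sum (\<Sum>i\<in>I. s i)) A"
  using assms by (induction I rule: infinite_finite_induct) (auto intro!: has_sum_add has_sum_0)

lemma has_sum_fps_to_fls:
  fixes f :: "complex fps"
  assumes "ereal (norm q) < fps_conv_radius f"
  shows "((\<lambda>n. fls_nth (fps_to_fls f) n * q powi n) has_sum eval_fps f q) UNIV"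
proof -
  have "((\<lambda>n. fps_nth f n * q ^ n) has_sum eval_fps f q) UNIV"
    by (rule norm_summable_imp_has_sum[OF norm_summable_fps sums_eval_fps]) (use assms in auto)
  then have "((\<lambda>n. fls_nth (fps_to_fls f) n * q powi n) has_sum eval_fps f q) (range int)"
    by (subst has_sum_reindex) (auto simp: o_def)
  then show ?thesis
  proof (rule has_sum_cong_neutral[THEN iffD1, rotated -1])
    fix n assume "n \<in> UNIV - range int"
    then have "n < 0" by (metis DiffD2 int_nat_eq linorder_not_less rangeI)
    then show "fls_nth (fps_to_fls f) n * q powi n = 0" by simp
  qed auto
qed

text \<open>Each summand of \<open>regularized_integral_eq\<close> is a power series converging on
  the unit disc times a monomial in log q, whose exponent is at most \<open>length fs\<close>; this
  gives the uniform degree bound.\<close>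

theorem has_qlog_expansion_regularized_integral:
  assumes "\<And>f. f \<in> set fs \<Longrightarrow> fps_conv_radius (complex_fps_of_rat f) \<ge> 1"
  shows "has_qlog_expansion (regularized_integral (map complex_fps_of_rat fs)) (qlog_expansion fs)"
  unfolding has_qlog_expansion_def
proof (intro conjI exI[of _ "length fs"] allI impI)
  have nth: "fls_nth (qlog_expansion fs) n =
      (\<Sum>i\<le>length fs. smult (fls_nth (fps_to_fls (reg_primitive (take i fs))) n)
          (monom (log_coeff (drop i fs)) (length fs - i)))" for n
    by (simp add: qlog_expansion_def fls_nth_sum fls_mult_const_nth del: fps_to_fls_nth)
  show "degree (fls_nth (qlog_expansion fs) n) \<le> length fs" for n
    unfolding nth
    by (intro degree_sum_le order_trans[OF degree_smult_le] order_trans[OF degree_monom_le]) auto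
  fix \<tau> :: complex assume \<tau>: "Im \<tau> > 0"
  let ?x = "2 * of_real pi * \<i> * \<tau>"
  let ?q = "exp ?x"
  let ?c = "\<lambda>i. of_rat (log_coeff (drop i fs)) * ?x ^ (length fs - i)"
  have q: "norm ?q < 1" using \<tau> by (simp add: norm_exp_eq_Re)
  have "((\<lambda>n. \<Sum>i\<le>length fs. fls_nth (fps_to_fls (complex_fps_of_rat (reg_primitive (take i fs)))) n * ?q powi n * ?c i)
      has_sum (\<Sum>i\<le>length fs. eval_fps (complex_fps_of_rat (reg_primitive (take i fs))) ?q * ?c i)) UNIV"
  proof (intro has_sum_sum has_sum_cmult_left has_sum_fps_to_fls)
    fix i
    have "1 \<le> fps_conv_radius (complex_fps_of_rat (reg_primitive (take i fs)))"
      unfolding complex_fps_of_rat_reg_primitive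
      by (rule reg_primitive_conv_radius) (use assms in \<open>auto dest: in_set_takeD\<close>)
    then show "ereal (norm ?q) < fps_conv_radius (complex_fps_of_rat (reg_primitive (take i fs)))"
      by (rule less_le_trans[rotated]) (use q in simp)
  qed
  also have "(\<Sum>i\<le>length fs. eval_fps (complex_fps_of_rat (reg_primitive (take i fs))) ?q * ?c i) =
      regularized_integral (map complex_fps_of_rat fs) \<tau>"
  proof -
    have "of_rat (\<Prod>f\<leftarrow>gs. fps_nth f 0) = (\<Prod>f\<leftarrow>gs. of_rat (fps_nth f 0) :: complex)" for gs :: "rat fps list"
      by (induction gs) (auto simp: of_rat_mult)
    moreover have "(of_rat (fact n) :: complex) = fact n" for n
      by (metis of_nat_fact of_rat_of_nat_eq)
    ultimately show ?thesis
      by (subst regularized_integral_eq)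
         (use assms \<tau> in \<open>auto simp: log_coeff_def of_rat_mult of_rat_divide of_rat_power of_rat_minus
            complex_fps_of_rat_reg_primitive take_map drop_map o_def\<close>)
  qed
  also have "(\<lambda>n. \<Sum>i\<le>length fs. fls_nth (fps_to_fls (complex_fps_of_rat (reg_primitive (take i fs)))) n * ?q powi n * ?c i) =
      (\<lambda>n. poly (map_poly of_rat (fls_nth (qlog_expansion fs) n)) ?x * ?q powi n)"
  proof
    fix n
    have "poly (map_poly of_rat (smult a (monom c m))) ?x = of_rat a * (of_rat c * ?x ^ m)" for a c m
      by (simp add: smult_monom map_poly_monom poly_monom of_rat_mult)
    moreover have "fls_nth (fps_to_fls (complex_fps_of_rat f)) n = of_rat (fls_nth (fps_to_fls f) n)" for f
      by simp
    ultimately show "(\<Sum>i\<le>length fs. fls_nth (fps_to_fls (complex_fps_of_rat (reg_primitive (take i fs)))) n * ?q powi n * ?c i) =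
      poly (map_poly of_rat (fls_nth (qlog_expansion fs) n)) ?x * ?q powi n"
      unfolding nth poly_map_of_rat_sum sum_distrib_right
      by (intro sum.cong) (simp_all del: fps_to_fls_nth add: mult_ac)
  qed
  finally show "((\<lambda>n. poly (map_poly of_rat (fls_nth (qlog_expansion fs) n)) ?x * ?q powi n)
      has_sum regularized_integral (map complex_fps_of_rat fs) \<tau>) UNIV" .
qed

section \<open>Independence of iterated primitives over a differential field\<close>

lemma derivation_sum:
  fixes D :: "'f::ab_group_add \<Rightarrow> 'g::ab_group_add"
  assumes "\<And>x y. D (x + y) = D x + D y"
  shows "D (\<Sum>i\<in>I. f i) = (\<Sum>i\<in>I. D (f i))"
proof -
  interpret additive D by standard (rule assms)
  show ?thesis by (rule sum)
qed

text \<open>\<open>E m w\<close> is the coefficient of \<open>(log q)\<^sup>m\<close> in the iterated primitive of the word \<open>w\<close>. A relation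
  of smallest maximal length, with the fewest words of that length, is normalized to have a
  coefficient \<open>1\<close> in front of a longest word, which \<open>D\<close> then removes.\<close>

theorem iterated_primitives_independent:
  fixes D :: "'f::field \<Rightarrow> 'f" and E :: "nat \<Rightarrow> 'k list \<Rightarrow> 'f" and g :: "'k \<Rightarrow> 'f"
  assumes D_add: "\<And>x y. D (x + y) = D x + D y"
    and D_mult: "\<And>x y. D (x * y) = D x * y + x * D y"
    and K_diff: "\<And>x y. x \<in> K \<Longrightarrow> y \<in> K \<Longrightarrow> x - y \<in> K"
    and K_mult: "\<And>x y. x \<in> K \<Longrightarrow> y \<in> K \<Longrightarrow> x * y \<in> K"
    and K_divide: "\<And>x y. x \<in> K \<Longrightarrow> y \<in> K \<Longrightarrow> x / y \<in> K"
    and K_D: "\<And>x. x \<in> K \<Longrightarrow> D x \<in> K"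
    and g: "\<And>k. g k \<in> K"
    and E_Nil: "E 0 [] \<noteq> 0" "\<And>m. D (E m []) = - (of_nat (Suc m) * E (Suc m) [])"
    and E_Cons: "\<And>m k w. D (E m (k # w)) = - (g k * E m w) - of_nat (Suc m) * E (Suc m) (k # w)"
    and crit: "\<And>A c h. finite A \<Longrightarrow> (\<And>k. k \<in> A \<Longrightarrow> c k \<in> K \<and> D (c k) = 0) \<Longrightarrow> h \<in> K \<Longrightarrow>
        (\<Sum>k\<in>A. c k * g k) = D h \<Longrightarrow> (\<And>k. k \<in> A \<Longrightarrow> c k = 0)"
    and a: "\<And>w. a w \<in> K" "finite {w. a w \<noteq> 0}"
    and rel: "\<And>m. (\<Sum>w | a w \<noteq> 0. a w * E m w) = 0"
  shows "a w = 0"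
proof -
  have K_0: "0 \<in> K" using K_diff[OF a(1)[of w] a(1)[of w]] by simp
  have K_add: "x + y \<in> K" if "x \<in> K" "y \<in> K" for x y
    using K_diff[OF that(1) K_diff[OF K_0 that(2)]] by simp
  have K_sum: "(\<Sum>k\<in>A. f k) \<in> K" if "\<And>k. k \<in> A \<Longrightarrow> f k \<in> K" for f and A :: "'k set"
    using that by (induction A rule: infinite_finite_induct) (auto intro: K_0 K_add)
  have "D 0 + D 0 = D 0 + 0" using D_add[of 0 0] by (simp only: add_0_right)
  then have D_0: "D 0 = 0" by (rule add_left_imp_eq)
  have "D 1 + D 1 = D 1 + 0" using D_mult[of 1 1] by (simp only: mult_1_left mult_1_right add_0_right)
  then have D_1: "D 1 = 0" by (rule add_left_imp_eq)

  define rels where "rels a \<longleftrightarrow> (\<forall>w. a w \<in> K) \<and> finite {w. a w \<noteq> 0} \<and>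
      (\<forall>m. (\<Sum>w | a w \<noteq> 0. a w * E m w) = 0)" for a
  have rels_superset: "rels a" if "\<And>w. a w \<in> K" "finite S" "\<And>w. a w \<noteq> 0 \<Longrightarrow> w \<in> S"
      "\<And>m. (\<Sum>w\<in>S. a w * E m w) = 0" for a S
  proof -
    have "(\<Sum>w | a w \<noteq> 0. a w * E m w) = (\<Sum>w\<in>S. a w * E m w)" for m
      by (rule sum.mono_neutral_left) (use that in auto)
    moreover have "finite {w. a w \<noteq> 0}" by (rule finite_subset[OF _ that(2)]) (use that(3) in auto)
    ultimately show ?thesis using that by (simp add: rels_def)
  qed

  have "\<forall>w. a w = 0" if "rels a" "\<And>w. a w \<noteq> 0 \<Longrightarrow> length w \<le> n" for n a
    using that
  proof (induction n arbitrary: a)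
    case 0
    then have "w = []" if "a w \<noteq> 0" for w using that by fastforce
    moreover have "a [] = 0"
    proof (rule ccontr)
      assume "a [] \<noteq> 0"
      with calculation have "{w. a w \<noteq> 0} = {[]}" by auto
      with "0.prems"(1) have "a [] * E 0 [] = 0" by (auto simp: rels_def)
      with \<open>a [] \<noteq> 0\<close> E_Nil(1) show False by simp
    qed
    ultimately show ?case by metis
  next
    case (Suc n)
    from Suc.prems show ?case
    proof (induction "card {w. a w \<noteq> 0 \<and> length w = Suc n}" arbitrary: a rule: less_induct)
      case less
      show ?case
      proof (cases "\<exists>w. a w \<noteq> 0 \<and> length w = Suc n")
        case False
        then have "length w \<le> n" if "a w \<noteq> 0" for w
          using less.prems(2)[OF that] that le_SucE by blast
        with less.prems(1) show ?thesis by (rule Suc.IH)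
      next
        case True
        then obtain w\<^sub>0 where w\<^sub>0: "a w\<^sub>0 \<noteq> 0" "length w\<^sub>0 = Suc n" by blast
        then obtain k\<^sub>0 v\<^sub>0 where w\<^sub>0_eq: "w\<^sub>0 = k\<^sub>0 # v\<^sub>0" and v\<^sub>0: "length v\<^sub>0 = n"
          by (auto simp: length_Suc_conv)
        define b where "b w = a w / a w\<^sub>0" for w
        define S where "S = {w. a w \<noteq> 0}"
        have S: "finite S" "w \<in> S \<longleftrightarrow> b w \<noteq> 0" for w
          using less.prems(1) w\<^sub>0(1) by (auto simp: rels_def S_def b_def)
        have bK: "b w \<in> K" for w
          using less.prems(1) by (auto simp: rels_def b_def intro: K_divide)
        have b_len: "length w \<le> Suc n" if "b w \<noteq> 0" for w
          using less.prems(2) that by (auto simp: b_def)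
        have b_w\<^sub>0: "b w\<^sub>0 = 1" using w\<^sub>0 by (simp add: b_def)
        have b_rel: "(\<Sum>w\<in>S. b w * E m w) = 0" for m
          using less.prems(1) by (simp add: rels_def S_def b_def flip: sum_divide_distrib)

        \<comment> \<open>Differentiating changes a coefficient or deletes a first letter, so the
          derived relation lives on \<open>T\<close> and uses letters from \<open>A\<close>. If
          \<open>[]\<close> is in \<open>S\<close>, then \<open>A\<close> also contains the
          unspecified \<open>hd []\<close>, which merely enlarges the sums.\<close>
        define A where "A = hd ` S"
        define T where "T = S \<union> tl ` S"
        have fin: "finite A" "finite T" using S by (auto simp: A_def T_def)
        \<comment> \<open>The derived relation collected by words: \<open>v\<close> receives
          \<open>D (b v)\<close> from itself and \<open>- (b (k # v) * g k)\<close> from each word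
          \<open>k # v\<close>.\<close>
        define c where "c v = D (b v) - (\<Sum>k\<in>A. b (k # v) * g k)" for v
        have b_A: "b (k # v) = 0" if "k \<notin> A" for k v
          using that S(2)[of "k # v"] by (force simp: A_def)
        have cK: "c v \<in> K" for v
          unfolding c_def by (intro K_diff K_D K_sum K_mult bK g)
        have c_T: "v \<in> T" if "c v \<noteq> 0" for v
        proof (rule ccontr)
          assume "v \<notin> T"
          then have "b v = 0" "\<And>k. b (k # v) = 0" using S(2) by (force simp: T_def)+
          with that show False by (simp add: c_def D_0)
        qed
        have c_rel: "(\<Sum>v\<in>T. c v * E m v) = 0" for m
        proof -
          define V where "V = (\<Sum>v\<in>T. \<Sum>k\<in>A. b (k # v) * g k * E m v)"
          define hg where "hg w = (case w of [] \<Rightarrow> 0 | k # v \<Rightarrow> g k * E m v)" for w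
          have D_E: "D (E m w) = - (of_nat (Suc m) * E (Suc m) w) - hg w" for w
            by (cases w) (auto simp: hg_def E_Nil E_Cons)
          have "0 = D (\<Sum>w\<in>S. b w * E m w)" by (simp add: b_rel D_0)
          also have "\<dots> = (\<Sum>w\<in>S. D (b w) * E m w - of_nat (Suc m) * (b w * E (Suc m) w) - b w * hg w)"
            unfolding derivation_sum[of D, OF D_add] D_mult D_E by (simp add: algebra_simps)
          also have "\<dots> = (\<Sum>w\<in>S. D (b w) * E m w) - (\<Sum>w\<in>S. b w * hg w)"
            by (simp add: sum_subtractf b_rel flip: sum_distrib_left del: of_nat_Suc)
          also have "(\<Sum>w\<in>S. D (b w) * E m w) = (\<Sum>v\<in>T. D (b v) * E m v)"
            by (rule sum.mono_neutral_left) (use S fin in \<open>auto simp: T_def D_0\<close>)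
          also have "(\<Sum>w\<in>S. b w * hg w) = (\<Sum>w\<in>S - {[]}. b w * hg w)"
            by (rule sum.mono_neutral_right) (use S in \<open>auto simp: hg_def\<close>)
          also have "\<dots> = (\<Sum>w\<in>(\<lambda>(v, k). k # v) ` (T \<times> A). b w * hg w)"
          proof (rule sum.mono_neutral_left)
            show "S - {[]} \<subseteq> (\<lambda>(v, k). k # v) ` (T \<times> A)"
            proof
              fix w assume w: "w \<in> S - {[]}"
              then have "(tl w, hd w) \<in> T \<times> A" by (auto simp: T_def A_def)
              moreover have "w = (\<lambda>(v, k). k # v) (tl w, hd w)" using w by simp
              ultimately show "w \<in> (\<lambda>(v, k). k # v) ` (T \<times> A)" by (rule rev_image_eqI)
            qed
          qed (use S fin in auto)
          also have "\<dots> = V"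
            by (subst sum.reindex) (auto simp: V_def hg_def inj_on_def sum.cartesian_product case_prod_unfold mult_ac)
          finally have "(\<Sum>v\<in>T. D (b v) * E m v) = V" by simp
          then show ?thesis
            by (simp add: c_def left_diff_distrib sum_subtractf V_def sum_distrib_right)
        qed
        have c_top: "c v = D (b v)" if "length v \<ge> Suc n" for v
        proof -
          have "b (k # v) = 0" for k using b_len[of "k # v"] that by force
          then show ?thesis by (simp add: c_def)
        qed
        have c_0: "c v = 0" for v
        proof -
          \<comment> \<open>On longest words \<open>c\<close> is \<open>D\<close> of
            \<open>b\<close>, so no new support appears there, and the normalization
            \<open>b w\<^sub>0 = 1\<close> removes \<open>w\<^sub>0\<close>. The induction on the
            number of longest words therefore applies to \<open>c\<close>.\<close>
          have "{w. c w \<noteq> 0 \<and> length w = Suc n} \<subset> {w. a w \<noteq> 0 \<and> length w = Suc n}"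
          proof
            show "{w. c w \<noteq> 0 \<and> length w = Suc n} \<subseteq> {w. a w \<noteq> 0 \<and> length w = Suc n}"
              by (auto simp: c_top b_def D_0)
            have "w\<^sub>0 \<notin> {w. c w \<noteq> 0 \<and> length w = Suc n}" by (simp add: c_top w\<^sub>0 b_w\<^sub>0 D_1)
            with w\<^sub>0 show "{w. c w \<noteq> 0 \<and> length w = Suc n} \<noteq> {w. a w \<noteq> 0 \<and> length w = Suc n}" by blast
          qed
          moreover have "finite {w. a w \<noteq> 0 \<and> length w = Suc n}"
            using S(1) by (rule finite_subset[rotated]) (auto simp: S_def)
          ultimately have "card {w. c w \<noteq> 0 \<and> length w = Suc n} < card {w. a w \<noteq> 0 \<and> length w = Suc n}"
            by (intro psubset_card_mono)
          moreover have "rels c" by (rule rels_superset[OF cK fin(2) c_T c_rel])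
          moreover have "length w \<le> Suc n" if "c w \<noteq> 0" for w
            using that c_top[of w] b_len[of w] D_0 by (metis nat_le_linear)
          ultimately show ?thesis using less.hyps by blast
        qed
        \<comment> \<open>Vanishing of \<open>c\<close> at the words \<open>k # v\<^sub>0\<close>
          makes their coefficients constants; vanishing at \<open>v\<^sub>0\<close> makes the
          corresponding combination of letters equal to \<open>D (b v\<^sub>0)\<close>.\<close>
        have "b (k\<^sub>0 # v\<^sub>0) = 0"
        proof (rule crit[of A "\<lambda>k. b (k # v\<^sub>0)" "b v\<^sub>0"])
          show "b (k # v\<^sub>0) \<in> K \<and> D (b (k # v\<^sub>0)) = 0" for k
            using c_top[of "k # v\<^sub>0"] c_0 bK v\<^sub>0 by simp
          show "(\<Sum>k\<in>A. b (k # v\<^sub>0) * g k) = D (b v\<^sub>0)"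
            using c_0[of v\<^sub>0] by (simp add: c_def)
          show "k\<^sub>0 \<in> A" using b_A b_w\<^sub>0 w\<^sub>0_eq by force
        qed (use fin bK in auto)
        with b_w\<^sub>0 w\<^sub>0_eq show ?thesis by simp
      qed
    qed
  qed
  moreover have "rels a" using a rel by (simp add: rels_def)
  moreover have "length w \<le> Max (length ` {w. a w \<noteq> 0})" if "a w \<noteq> 0" for w
    using a(2) that by (intro Max_ge) auto
  ultimately show ?thesis by blast
qed

section \<open>Divisor power sums\<close>

lemma sum_divisors_prime_power:
  fixes f :: "nat \<Rightarrow> 'a::comm_monoid_add"
  assumes "prime p"
  shows "(\<Sum>d | d dvd p ^ j. f d) = (\<Sum>i\<le>j. f (p ^ i))"
proof -
  have "{d. d dvd p ^ j} = (\<lambda>i. p ^ i) ` {..j}"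
    using divides_primepow_nat[OF assms] by auto
  moreover have "inj_on (\<lambda>i. p ^ i) {..j}"
    using prime_gt_1_nat[OF assms] by (auto simp: inj_on_def)
  ultimately show ?thesis by (simp add: sum.reindex)
qed

text \<open>If \<open>x\<close> were nonzero, a prime larger than the absolute value of
  \<open>N * x\<close> would divide neither \<open>N\<close> nor \<open>x\<close>.\<close>

lemma int_eq_0_if_primes_dvd:
  fixes x N :: int
  assumes "N \<noteq> 0" "\<And>p. prime p \<Longrightarrow> \<not> int p dvd N \<Longrightarrow> int p dvd x"
  shows "x = 0"
proof (rule ccontr)
  assume "x \<noteq> 0"
  obtain p where p: "prime p" "p > nat \<bar>N * x\<bar>" using bigger_prime by blast
  have "\<bar>N * x\<bar> > 0" using \<open>x \<noteq> 0\<close> \<open>N \<noteq> 0\<close> by simp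
  with p(2) have "\<not> int p dvd N * x"
    using zdvd_not_zless[of "\<bar>N * x\<bar>" "int p"] by auto
  with assms(2)[OF p(1)] show False by (meson dvd_mult dvd_mult2)
qed

text \<open>The coefficient at \<open>p\<^sup>2\<^sup>k\<close> for the smallest index \<open>k\<close> with nonzero coefficient is
  congruent to \<open>s\<^sub>k p\<^sup>2\<^sup>k\<^sup>-\<^sup>1\<close> modulo \<open>p\<^sup>2\<^sup>k\<close>, once the sum of all coefficients is known to
  vanish from the case of the coefficient at \<open>p\<close>.\<close>

lemma prime_power_divisor_sums_independent:
  fixes s :: "nat \<Rightarrow> int" and N :: int
  assumes A: "finite A" "0 \<notin> A" and N: "N \<noteq> 0"
    and dvd: "\<And>p j. prime p \<Longrightarrow> \<not> int p dvd N \<Longrightarrow>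
      int p ^ j dvd (\<Sum>k\<in>A. s k * (\<Sum>i\<le>j. int p ^ (i * (2 * k - 1))))"
  shows "\<forall>k\<in>A. s k = 0"
proof (rule ccontr)
  assume "\<not> (\<forall>k\<in>A. s k = 0)"
  then have ex: "\<exists>k. k \<in> A \<and> s k \<noteq> 0" by blast
  define K where "K = (LEAST k. k \<in> A \<and> s k \<noteq> 0)"
  have K: "K \<in> A" "s K \<noteq> 0" using LeastI_ex[OF ex] by (auto simp: K_def)
  have less: "s k = 0" if "k \<in> A" "k < K" for k
    using not_less_Least[of k "\<lambda>k. k \<in> A \<and> s k \<noteq> 0"] that by (auto simp: K_def)
  have pos: "k > 0" if "k \<in> A" for k using that A(2) by (cases k) auto
  \<comment> \<open>The divisor 1, that is \<open>i = 0\<close>, contributes the sum of all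
    \<open>s k\<close>, the only part without a power of p in sight.\<close>
  have split: "(\<Sum>k\<in>A. s k * (\<Sum>i\<le>j. int p ^ (i * (2 * k - 1)))) =
      (\<Sum>k\<in>A. s k) + (\<Sum>k\<in>A. s k * (\<Sum>i\<in>{1..j}. int p ^ (i * (2 * k - 1))))" for p j
  proof -
    have "{..j} = insert 0 {1..j}" by auto
    then show ?thesis by (simp add: distrib_left sum.distrib)
  qed
  have sum_0: "(\<Sum>k\<in>A. s k) = 0"
  proof (rule int_eq_0_if_primes_dvd[OF N])
    fix p assume p: "prime p" "\<not> int p dvd N"
    have "int p dvd (\<Sum>k\<in>A. s k * (\<Sum>i\<in>{1..1}. int p ^ (i * (2 * k - 1))))"
      by (intro dvd_sum dvd_mult) (auto intro!: dvd_power dest: pos)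
    with dvd[OF p, of 1] show "int p dvd (\<Sum>k\<in>A. s k)"
      unfolding split by (simp add: dvd_add_left_iff)
  qed
  have "s K = 0"
  proof (rule int_eq_0_if_primes_dvd[OF N])
    fix p assume p: "prime p" "\<not> int p dvd N"
    let ?t = "\<lambda>k i. int p ^ (i * (2 * k - 1))"
    \<comment> \<open>All exponents except that of \<open>(K, 1)\<close> reach \<open>2 * K\<close>:
      for \<open>i = 1\<close> the index exceeds \<open>K\<close>, so \<open>2 * k - 1\<close> is
      already larger, and for \<open>i \<ge> 2\<close> one has
      \<open>2 * (2 * k - 1) \<ge> 2 * k\<close> since \<open>k \<ge> 1\<close>.\<close>
    have rest: "int p ^ (2 * K) dvd s k * ?t k i" if "k \<in> A" "i \<in> {1..2 * K}" "k \<noteq> K \<or> i \<noteq> 1" for k i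
    proof (cases "k < K")
      case False
      have "2 * K \<le> i * (2 * k - 1)"
      proof (cases "i = 1")
        case True
        then show ?thesis using that False by auto
      next
        case i: False
        then have "2 * (2 * k - 1) \<le> i * (2 * k - 1)" using that by (intro mult_right_mono) auto
        moreover have "2 * K \<le> 2 * (2 * k - 1)" using False pos[OF K(1)] by simp
        ultimately show ?thesis by (rule order_trans[rotated])
      qed
      then show ?thesis by (intro dvd_mult le_imp_power_dvd)
    qed (use less that in simp)
    have "(\<Sum>k\<in>A. s k * (\<Sum>i\<in>{1..2 * K}. ?t k i)) = (\<Sum>(k, i)\<in>A \<times> {1..2 * K}. s k * ?t k i)"
      by (simp add: sum_distrib_left sum.cartesian_product)
    also have "\<dots> = s K * ?t K 1 + (\<Sum>(k, i)\<in>A \<times> {1..2 * K} - {(K, 1)}. s k * ?t k i)"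
      using A(1) K(1) pos[OF K(1)] by (subst sum.remove[of _ "(K, 1)"]) auto
    finally have "int p ^ (2 * K) dvd s K * ?t K 1 + (\<Sum>(k, i)\<in>A \<times> {1..2 * K} - {(K, 1)}. s k * ?t k i)"
      using dvd[OF p, of "2 * K"] unfolding split sum_0 by simp
    moreover have "int p ^ (2 * K) dvd (\<Sum>(k, i)\<in>A \<times> {1..2 * K} - {(K, 1)}. s k * ?t k i)"
    proof (rule dvd_sum)
      fix x assume "x \<in> A \<times> {1..2 * K} - {(K, 1)}"
      then show "int p ^ (2 * K) dvd (case x of (k, i) \<Rightarrow> s k * ?t k i)"
        using rest[of "fst x" "snd x"] by (cases x) auto
    qed
    ultimately have "int p ^ (2 * K) dvd s K * int p ^ (2 * K - 1)"
      by (simp add: dvd_add_left_iff)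
    moreover have "int p ^ (2 * K) = int p * int p ^ (2 * K - 1)"
      using pos[OF K(1)] by (cases K) simp_all
    ultimately show "int p dvd s K"
      using prime_gt_0_nat[OF p(1)] by simp
  qed
  with K(2) show False by simp
qed

section \<open>Quotients of integral power series\<close>

text \<open>The derivation acts on Laurent series, so the scalar field is handled as a subfield of
  Q((q)) instead of as abstract fractions.\<close>

definition integral_quotients :: "rat fls set" where
  "integral_quotients = {laurent_of_int_fps a / laurent_of_int_fps b | a b. b \<noteq> 0}"

lemma range_laurent_of_fract: "range laurent_of_fract = integral_quotients"
proof (intro equalityI subsetI)
  fix x assume "x \<in> range laurent_of_fract"
  then obtain c where "x = laurent_of_fract c" by blast
  then show "x \<in> integral_quotients"
    by (cases c) (auto simp: laurent_of_fract_Fract integral_quotients_def)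
next
  fix x assume "x \<in> integral_quotients"
  then show "x \<in> range laurent_of_fract"
    by (auto simp: integral_quotients_def simp flip: laurent_of_fract_Fract)
qed

lemma laurent_of_int_fps_diff:
  "laurent_of_int_fps (a - b) = laurent_of_int_fps a - laurent_of_int_fps b"
  using laurent_of_int_fps_hom(1)[of "a - b" b] by (simp add: algebra_simps)

lemma laurent_of_int_fps_0 [simp]: "laurent_of_int_fps 0 = 0"
  by (simp add: laurent_of_int_fps_hom(4))

lemma laurent_of_int_fps_in_integral_quotients: "laurent_of_int_fps a \<in> integral_quotients"
  unfolding integral_quotients_def
  by (rule CollectI, rule exI[of _ a], rule exI[of _ 1]) (simp add: laurent_of_int_fps_hom)

lemma integral_quotients_diff:
  assumes "x \<in> integral_quotients" "y \<in> integral_quotients"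
  shows "x - y \<in> integral_quotients"
proof -
  from assms obtain a b c d where *: "x = laurent_of_int_fps a / laurent_of_int_fps b"
    "y = laurent_of_int_fps c / laurent_of_int_fps d" "b \<noteq> 0" "d \<noteq> 0"
    by (auto simp: integral_quotients_def)
  then have "x - y = laurent_of_int_fps (a * d - c * b) / laurent_of_int_fps (b * d)"
    by (simp add: laurent_of_int_fps_diff laurent_of_int_fps_hom diff_frac_eq)
  with * show ?thesis unfolding integral_quotients_def by (metis (mono_tags, lifting) mem_Collect_eq mult_eq_0_iff)
qed

lemma integral_quotients_mult:
  assumes "x \<in> integral_quotients" "y \<in> integral_quotients"
  shows "x * y \<in> integral_quotients"
proof -
  from assms obtain a b c d where *: "x = laurent_of_int_fps a / laurent_of_int_fps b"
    "y = laurent_of_int_fps c / laurent_of_int_fps d" "b \<noteq> 0" "d \<noteq> 0"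
    by (auto simp: integral_quotients_def)
  then have "x * y = laurent_of_int_fps (a * c) / laurent_of_int_fps (b * d)"
    by (simp add: laurent_of_int_fps_hom)
  with * show ?thesis unfolding integral_quotients_def by (metis (mono_tags, lifting) mem_Collect_eq mult_eq_0_iff)
qed

lemma integral_quotients_inverse:
  assumes "x \<in> integral_quotients"
  shows "inverse x \<in> integral_quotients"
proof (cases "x = 0")
  case False
  from assms obtain a b where *: "x = laurent_of_int_fps a / laurent_of_int_fps b" "b \<noteq> 0"
    by (auto simp: integral_quotients_def)
  with False have "a \<noteq> 0" by auto
  moreover have "inverse x = laurent_of_int_fps b / laurent_of_int_fps a" using * by simp
  ultimately show ?thesis unfolding integral_quotients_def by blast
qed (use assms in simp)

lemma integral_quotients_divide:
  "x \<in> integral_quotients \<Longrightarrow> y \<in> integral_quotients \<Longrightarrow> x / y \<in> integral_quotients"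
  unfolding divide_inverse by (intro integral_quotients_mult integral_quotients_inverse)

definition q_deriv :: "'a::comm_ring_1 fls \<Rightarrow> 'a fls" where
  "q_deriv f = fls_X * fls_deriv f"

lemma q_deriv_nth [simp]: "fls_nth (q_deriv f) n = of_int n * fls_nth f n"
  by (simp add: q_deriv_def fls_X_times_conv_shift)

lemma q_deriv_0 [simp]: "q_deriv 0 = 0"
  by (simp add: q_deriv_def)

lemma q_deriv_1 [simp]: "q_deriv 1 = 0"
  by (simp add: q_deriv_def)

lemma q_deriv_add: "q_deriv (f + g) = q_deriv f + q_deriv g"
  by (simp add: fls_eq_iff distrib_left)

lemma q_deriv_mult: "q_deriv (f * g) = q_deriv f * g + f * q_deriv g"
  by (simp add: q_deriv_def distrib_left mult_ac)

lemma q_deriv_laurent_of_int_fps: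
  "q_deriv (laurent_of_int_fps a) = laurent_of_int_fps (fps_X * fps_deriv a)"
proof (rule fls_eqI)
  fix n show "fls_nth (q_deriv (laurent_of_int_fps a)) n = fls_nth (laurent_of_int_fps (fps_X * fps_deriv a)) n"
    by (auto simp: laurent_of_int_fps_def fps_X_mult_nth of_nat_nat)
qed

text \<open>Solving the product rule for \<open>x * b = a\<close> gives the quotient rule, and
  \<open>D\<close> preserves integral power series.\<close>

lemma integral_quotients_q_deriv:
  assumes "x \<in> integral_quotients"
  shows "q_deriv x \<in> integral_quotients"
proof -
  from assms obtain a b where *: "x = laurent_of_int_fps a / laurent_of_int_fps b" "b \<noteq> 0"
    by (auto simp: integral_quotients_def)
  let ?b = "laurent_of_int_fps b"
  have b: "?b \<noteq> 0" using *(2) by (simp add: laurent_of_int_fps_hom)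
  have "q_deriv (x * ?b) = q_deriv x * ?b + x * q_deriv ?b" by (rule q_deriv_mult)
  moreover have "x * ?b = laurent_of_int_fps a" using * b by simp
  ultimately have "q_deriv x = (q_deriv (laurent_of_int_fps a) - x * q_deriv ?b) / ?b"
    using b by (simp add: field_simps)
  also have "\<dots> \<in> integral_quotients"
    unfolding q_deriv_laurent_of_int_fps
    by (intro integral_quotients_divide integral_quotients_diff integral_quotients_mult assms
        laurent_of_int_fps_in_integral_quotients)
  finally show ?thesis .
qed

lemma fps_to_fls_in_integral_quotients:
  fixes f :: "rat fps"
  assumes "d \<noteq> 0" "\<And>n. of_int d * fps_nth f n \<in> \<int>"
  shows "fps_to_fls f \<in> integral_quotients"
proof -
  define a where "a = Abs_fps (\<lambda>n. \<lfloor>of_int d * fps_nth f n\<rfloor>)"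
  have a: "of_int (fps_nth a n) = of_int d * fps_nth f n" for n
    using assms(2)[of n] by (auto simp: a_def elim: Ints_cases)
  have d: "Abs_fps (\<lambda>n. of_int (fps_nth (fps_const d) n)) = fps_const (of_int d :: rat)"
    by (auto simp: fps_eq_iff)
  have "fps_to_fls f * laurent_of_int_fps (fps_const d) = laurent_of_int_fps a"
    unfolding laurent_of_int_fps_def fls_times_fps_to_fls[symmetric] fps_to_fls_eq_iff
    unfolding d by (simp add: fps_eq_iff a mult.commute)
  moreover have "laurent_of_int_fps (fps_const d) \<noteq> 0"
    using assms(1) by (simp add: laurent_of_int_fps_hom)
  ultimately have "fps_to_fls f = laurent_of_int_fps a / laurent_of_int_fps (fps_const d)"
    by (simp add: field_simps)
  then show ?thesis
    by (simp add: integral_quotients_divide laurent_of_int_fps_in_integral_quotients)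
qed

text \<open>After a power of q is split off the denominator, its constant term is its former leading
  coefficient \<open>N\<close>. The recursion for the coefficients of the quotient divides by
  \<open>N\<close> only, once per step; the exponent of \<open>N\<close> may grow with
  \<open>n\<close>.\<close>

lemma integral_quotients_denominators:
  assumes "x \<in> integral_quotients"
  obtains N :: int where "N \<noteq> 0" "\<And>n. \<exists>j. of_int N ^ j * fls_nth x n \<in> \<int>"
proof -
  from assms obtain a b where *: "x = laurent_of_int_fps a / laurent_of_int_fps b" "b \<noteq> 0"
    by (auto simp: integral_quotients_def)
  define s where "s = subdegree b"
  define N where "N = fps_nth b s"
  have N: "N \<noteq> 0" using *(2) by (simp add: N_def s_def)
  \<comment> \<open>This is the ring Z[1/N].\<close>
  define R where "R = {y::rat. \<exists>j. of_int N ^ j * y \<in> \<int>}"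
  have R_sum: "(\<Sum>i\<in>I. f i) \<in> R" if "finite I" "\<And>i. i \<in> I \<Longrightarrow> f i \<in> R" for f and I :: "nat set"
    using that
  proof (induction I rule: finite_induct)
    case (insert i I)
    then have "f i \<in> R" "(\<Sum>i\<in>I. f i) \<in> R" by auto
    then obtain j k where jk: "of_int N ^ j * f i \<in> \<int>" "of_int N ^ k * (\<Sum>i\<in>I. f i) \<in> \<int>"
      unfolding R_def by blast
    have "of_int N ^ k * (of_int N ^ j * f i) + of_int N ^ j * (of_int N ^ k * (\<Sum>i\<in>I. f i)) \<in> \<int>"
      using Ints_add[OF Ints_mult[OF Ints_power[OF Ints_of_int] jk(1)] Ints_mult[OF Ints_power[OF Ints_of_int] jk(2)]] .
    then have "of_int N ^ (j + k) * (\<Sum>i\<in>insert i I. f i) \<in> \<int>"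
      using insert.hyps by (simp add: power_add algebra_simps)
    then show ?case unfolding R_def by blast
  qed (simp add: R_def)
  have R_int: "of_int m \<in> R" for m
    unfolding R_def by (rule CollectI, rule exI[of _ 0]) simp
  have R_mult_int: "y * of_int m \<in> R" if "y \<in> R" for y m
  proof -
    from that obtain j where "of_int N ^ j * y \<in> \<int>" by (auto simp: R_def)
    then have "of_int N ^ j * y * of_int m \<in> \<int>" by (rule Ints_mult) auto
    then show ?thesis by (auto simp: R_def mult.assoc)
  qed
  have R_diff: "y - z \<in> R" if "y \<in> R" "z \<in> R" for y z
    using R_sum[of "{0, 1}" "\<lambda>i. if i = 0 then y else z * of_int (- 1)"] R_mult_int[of z "- 1"] that by simp
  have R_divide: "y / of_int N \<in> R" if "y \<in> R" for y
  proof -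
    from that obtain j where "of_int N ^ j * y \<in> \<int>" by (auto simp: R_def)
    then have "of_int N ^ Suc j * (y / of_int N) \<in> \<int>" using N by simp
    then show ?thesis unfolding R_def by blast
  qed

  define A B B' where "A = Abs_fps (\<lambda>n. of_int (fps_nth a n) :: rat)"
    "B = Abs_fps (\<lambda>n. of_int (fps_nth b n) :: rat)" "B' = fps_shift s B"
  have B'_0: "fps_nth B' 0 = of_int N" by (simp add: A_B_B'_def N_def)
  define H where "H = A * inverse B'"
  have "H * B' = A"
    using inverse_mult_eq_1[of B'] B'_0 N by (simp add: H_def mult.assoc)
  have H: "fps_nth H n \<in> R" for n
  proof (induction n rule: less_induct)
    case (less n)
    have "(\<Sum>i=0..n. fps_nth H i * fps_nth B' (n - i)) = fps_nth A n"
      using \<open>H * B' = A\<close> by (simp flip: fps_mult_nth)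
    moreover have "{0..n} = insert n {..<n}" by auto
    ultimately have "fps_nth H n * of_int N = fps_nth A n - (\<Sum>i<n. fps_nth H i * fps_nth B' (n - i))"
      by (simp add: B'_0 algebra_simps)
    then have eq: "fps_nth H n = (fps_nth A n - (\<Sum>i<n. fps_nth H i * fps_nth B' (n - i))) / of_int N"
      using N by (simp add: field_simps)
    have "(\<Sum>i<n. fps_nth H i * fps_nth B' (n - i)) \<in> R"
      by (rule R_sum) (auto simp: A_B_B'_def intro!: R_mult_int less.IH)
    then show ?case unfolding eq by (intro R_divide R_diff) (simp_all add: A_B_B'_def R_int)
  qed
  have B_eq: "B = B' * fps_X ^ s"
  proof -
    have "s \<le> subdegree B"
    proof (rule subdegree_geI)
      have "fps_nth B s = of_int N" by (simp add: A_B_B'_def N_def)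
      with N show "B \<noteq> 0" by auto
      show "fps_nth B i = 0" if "i < s" for i
        using nth_less_subdegree_zero[of i b] that by (simp add: A_B_B'_def s_def)
    qed
    then show ?thesis by (simp add: A_B_B'_def fps_shift_times_fps_X_power)
  qed
  have "x * fps_to_fls B = fps_to_fls A"
    using * by (simp add: laurent_of_int_fps_def A_B_B'_def flip: laurent_of_int_fps_hom(4))
  also have "fps_to_fls A = fps_to_fls H * fps_to_fls B'"
    by (simp add: \<open>H * B' = A\<close> flip: fls_times_fps_to_fls)
  finally have "(x * fls_X ^ s) * fps_to_fls B' = fps_to_fls H * fps_to_fls B'"
    by (simp add: B_eq fls_times_fps_to_fls fps_to_fls_power mult_ac)
  moreover have "B' \<noteq> 0" using B'_0 N by auto
  ultimately have x: "x * fls_X ^ s = fps_to_fls H" by simp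
  have "fls_nth x n \<in> R" for n
  proof -
    have "fls_nth x n = fls_nth (x * fls_X ^ s) (n + int s)"
      by (simp add: fls_X_power_times_conv_shift)
    also have "\<dots> \<in> R" unfolding x using H R_int[of 0] by auto
    finally show ?thesis .
  qed
  with N show thesis by (intro that[of N]) (auto simp: R_def)
qed

section \<open>Eisenstein series modulo derivatives\<close>

lemma rat_denominator: obtains d :: int where "d \<noteq> 0" "of_int d * (c :: rat) \<in> \<int>"
proof -
  obtain a b where "quotient_of c = (a, b)" by fastforce
  then have "b > 0" "c = of_int a / of_int b"
    by (auto intro: quotient_of_denom_pos quotient_of_div)
  then show thesis by (intro that[of b]) auto
qed

lemma common_denominator:
  fixes r :: "'k \<Rightarrow> rat"
  assumes "finite A"
  shows "\<exists>d::int. d \<noteq> 0 \<and> (\<forall>k\<in>A. of_int d * r k \<in> \<int>)"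
  using assms
proof (induction A rule: finite_induct)
  case (insert k A)
  then obtain d where d: "d \<noteq> 0" "\<And>k. k \<in> A \<Longrightarrow> of_int d * r k \<in> \<int>" by blast
  obtain e where e: "e \<noteq> 0" "of_int e * r k \<in> \<int>" by (rule rat_denominator)
  have "of_int (d * e) * r l \<in> \<int>" if "l \<in> insert k A" for l
    using that Ints_mult[OF Ints_of_int[of d] e(2)] Ints_mult[OF Ints_of_int[of e] d(2)[of l]]
    by (auto simp: mult_ac)
  with d(1) e(1) show ?case by (intro exI[of _ "d * e"]) auto
qed (auto intro: exI[of _ 1])

lemma eisenstein_rat_in_integral_quotients: "fps_to_fls (eisenstein_rat k) \<in> integral_quotients"
proof -
  obtain d where d: "d \<noteq> 0" "of_int d * fps_nth (eisenstein_rat k) 0 \<in> \<int>"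
    by (rule rat_denominator)
  have "fps_nth (eisenstein_rat k) n \<in> \<int>" if "n \<noteq> 0" for n
    using that by (auto simp: eisenstein_rat_def intro!: Ints_sum Ints_power)
  then have "of_int d * fps_nth (eisenstein_rat k) n \<in> \<int>" for n
    using d(2) by (cases "n = 0") (auto intro: Ints_mult)
  with d(1) show ?thesis by (rule fps_to_fls_in_integral_quotients)
qed

theorem eisenstein_independent_modulo_derivatives:
  fixes r :: "nat \<Rightarrow> rat"
  assumes A: "finite A" and h: "h \<in> integral_quotients"
    and eq: "(\<Sum>k\<in>A. fls_const (r k) * fps_to_fls (eisenstein_rat k)) = q_deriv h"
  shows "\<forall>k\<in>A. r k = 0"
proof -
  obtain N :: int where N: "N \<noteq> 0" "\<And>n. \<exists>j. of_int N ^ j * fls_nth h n \<in> \<int>"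
    using integral_quotients_denominators[OF h] by blast
  obtain d :: int where d: "d \<noteq> 0" "\<And>k. k \<in> A \<Longrightarrow> of_int d * r k \<in> \<int>"
    using common_denominator[OF A, of r] by blast
  define s where "s k = \<lfloor>of_int d * r k\<rfloor>" for k
  have s: "of_int (s k) = of_int d * r k" if "k \<in> A" for k
    using d(2)[OF that] by (auto simp: s_def elim: Ints_cases)
  have coeff: "(\<Sum>k\<in>A. r k * fps_nth (eisenstein_rat k) n) = of_nat n * fls_nth h (int n)" for n
    using arg_cong[OF eq, of "\<lambda>f. fls_nth f (int n)"] by (simp add: fls_nth_sum)
  have "\<forall>k\<in>A - {0}. s k = 0"
  proof (rule prime_power_divisor_sums_independent[OF _ _ N(1)])
    fix p j assume p: "prime (p::nat)" "\<not> int p dvd N"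
    let ?n = "p ^ j"
    define \<sigma> where "\<sigma> = (\<Sum>k\<in>A - {0}. s k * (\<Sum>i\<le>j. int p ^ (i * (2 * k - 1))))"
    have n: "?n \<noteq> 0" using prime_gt_0_nat[OF p(1)] by simp
    have "(\<Sum>k\<in>A. r k * fps_nth (eisenstein_rat k) ?n) =
        (\<Sum>k\<in>A - {0}. r k * fps_nth (eisenstein_rat k) ?n)"
      by (rule sum.mono_neutral_right) (use A n in \<open>auto simp: eisenstein_rat_def\<close>)
    also have "\<dots> = (\<Sum>k\<in>A - {0}. r k * (\<Sum>i\<le>j. of_nat p ^ (i * (2 * k - 1))))"
      using n by (intro sum.cong) (auto simp: eisenstein_rat_def sum_divisors_prime_power[OF p(1)] power_mult)
    also have "of_int d * \<dots> = of_int \<sigma>"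
      unfolding \<sigma>_def of_int_sum of_int_mult sum_distrib_left
      by (intro sum.cong) (auto simp: s mult.assoc sum_distrib_left)
    finally have \<sigma>: "of_int \<sigma> = of_int d * (of_nat ?n * fls_nth h (int ?n))"
      unfolding coeff by (rule sym)
    \<comment> \<open>The power of \<open>N\<close> clears the denominator of this coefficient of
      \<open>h\<close>. Since p does not divide \<open>N\<close>, it can be cancelled again after
      comparing integers.\<close>
    obtain e z where "of_int N ^ e * fls_nth h (int ?n) = of_int z"
      using N(2)[of "int ?n"] by (auto elim: Ints_cases)
    then have "(of_int (N ^ e * \<sigma>) :: rat) = of_int (int p ^ j * (d * z))"
      by (simp add: \<sigma> algebra_simps)
    then have "N ^ e * \<sigma> = int p ^ j * (d * z)" by (simp only: of_int_eq_iff)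
    then have "int p ^ j dvd N ^ e * \<sigma>" by simp
    moreover have "coprime (int p) N" using p by (intro prime_imp_coprime) auto
    then have "coprime (int p ^ j) (N ^ e)" by simp
    ultimately show "int p ^ j dvd (\<Sum>k\<in>A - {0}. s k * (\<Sum>i\<le>j. int p ^ (i * (2 * k - 1))))"
      by (simp add: coprime_dvd_mult_right_iff \<sigma>_def)
  qed (use A in auto)
  then have pos: "r k = 0" if "k \<in> A" "k \<noteq> 0" for k
    using s[of k] d(1) that by auto
  have "r 0 = 0" if "0 \<in> A"
  proof -
    have "(\<Sum>k\<in>A. r k * fps_nth (eisenstein_rat k) 0) = (\<Sum>k\<in>{0}. r k * fps_nth (eisenstein_rat k) 0)"
      by (rule sum.mono_neutral_right) (use A that pos in auto)
    then show ?thesis using coeff[of 0] by (simp add: eisenstein_rat_def)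
  qed
  with pos show ?thesis by metis
qed

section \<open>Independence of the expansions\<close>

text \<open>The coefficient of the m-th power of log q in \<open>qlog_expansion fs\<close>: only the
  cut that leaves the last \<open>m\<close> letters to the constant integral contributes.\<close>

definition log_component :: "nat \<Rightarrow> rat fps list \<Rightarrow> rat fls" where
  "log_component m fs = (if m \<le> length fs then
     fls_const (log_coeff (drop (length fs - m) fs)) * fps_to_fls (reg_primitive (take (length fs - m) fs))
     else 0)"

text \<open>Scalars are free of log q, so taking a coefficient in log q is linear over them. This
  splits a relation in the algebra into relations between Laurent series.\<close>

lemma coeff_scaled_qlog_expansion:
  "coeff (fls_nth (fls_const_coeffs a * qlog_expansion fs) n) m = fls_nth (a * log_component m fs) n"
proof -
  let ?J = "\<lambda>i. a * fps_to_fls (reg_primitive (take i fs))"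
  let ?c = "\<lambda>i. log_coeff (drop i fs)"
  have "fls_const_coeffs a * qlog_expansion fs =
      (\<Sum>i\<le>length fs. fls_const_coeffs (?J i) * fls_const (monom (?c i) (length fs - i)))"
    by (simp add: qlog_expansion_def sum_distrib_left fls_const_coeffs_hom mult.assoc)
  then have "coeff (fls_nth (fls_const_coeffs a * qlog_expansion fs) n) m =
      (\<Sum>i\<le>length fs. fls_nth (?J i) n * (if length fs - i = m then ?c i else 0))"
    by (simp add: fls_nth_sum coeff_sum)
  also have "\<dots> = (\<Sum>i\<in>{i. i \<le> length fs \<and> length fs - i = m}. fls_nth (?J i) n * ?c i)"
    by (rule sum.mono_neutral_cong_right) auto
  also have "{i. i \<le> length fs \<and> length fs - i = m} = (if m \<le> length fs then {length fs - m} else {})"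
    by auto
  also have "(\<Sum>i\<in>\<dots>. fls_nth (?J i) n * ?c i) = fls_nth (a * log_component m fs) n"
  proof -
    have "a * log_component m fs = (if m \<le> length fs then fls_const (?c (length fs - m)) * ?J (length fs - m) else 0)"
      by (simp add: log_component_def mult.left_commute)
    then show ?thesis by (simp add: mult.commute)
  qed
  finally show ?thesis .
qed

lemma log_component_Nil: "log_component m [] = (if m = 0 then 1 else 0)"
  by (simp add: log_component_def log_coeff_def)

lemma log_coeff_Cons:
  "log_coeff (f # fs) * of_nat (Suc (length fs)) = - (fps_nth f 0 * log_coeff fs)"
  by (simp add: log_coeff_def field_simps del: of_nat_Suc)

lemma q_deriv_reg_primitive:
  "q_deriv (fps_to_fls (reg_primitive (f # fs))) =
     fls_const (fps_nth (last (f # fs)) 0) * fps_to_fls (reg_primitive (butlast (f # fs))) -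
     fps_to_fls f * fps_to_fls (reg_primitive fs)"
proof -
  have "q_deriv (fps_to_fls (reg_primitive (f # fs))) = fps_to_fls (fps_X * fps_deriv (reg_primitive (f # fs)))"
    by (simp add: q_deriv_def fls_deriv_fps_to_fls fls_times_fps_to_fls)
  then show ?thesis
    unfolding reg_primitive_derivative by (simp add: fls_times_fps_to_fls del: butlast.simps last.simps)
qed

lemma q_deriv_const_mult: "q_deriv (fls_const c * f) = fls_const c * q_deriv f"
  by (simp add: q_deriv_def mult.left_commute)

text \<open>The derivative of the power series factor either loses the first letter \<open>f\<close>
  or drops its last letter, whose constant term then joins the log coefficient. By
  \<open>log_coeff_Cons\<close> the second part is the component for \<open>Suc m\<close>.\<close>

lemma q_deriv_log_component:
  "q_deriv (log_component m (f # fs)) =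
     - (fps_to_fls f * log_component m fs) - of_nat (Suc m) * log_component (Suc m) (f # fs)"
proof -
  let ?n = "length fs" and ?l = "f # fs"
  \<comment> \<open>For \<open>m = Suc ?n\<close> the component is a pure constant and both sides
    vanish; beyond that every component is zero.\<close>
  consider "m \<le> ?n" | "m = Suc ?n" | "m > Suc ?n" by linarith
  then show ?thesis
  proof cases
    case 1
    \<comment> \<open>The power series factor of \<open>f # fs\<close> belongs to the prefix
      \<open>f # take i fs\<close>, that of \<open>fs\<close> to \<open>take i fs\<close>.\<close>
    define i where "i = ?n - m"
    have i: "i \<le> ?n" "?n - m = i" "Suc ?n - m = Suc i" "m = ?n - i" using 1 by (auto simp: i_def)
    have last: "last (f # take i fs) = ?l ! i"
      using i(1) by (cases i) (auto simp: last_conv_nth)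
    have butlast: "butlast (f # take i fs) = take i ?l"
      using i(1) butlast_take[of "Suc i" ?l] by simp
    have "drop i ?l = ?l ! i # drop i fs"
      using Cons_nth_drop_Suc[of i ?l] i(1) by simp
    then have c: "fls_const (log_coeff (drop i fs)) * fls_const (fps_nth (?l ! i) 0) =
        - (of_nat (Suc m) * fls_const (log_coeff (drop i ?l)))"
      using log_coeff_Cons[of "?l ! i" "drop i fs"] i(1,4)
      by (simp add: fls_of_nat mult.commute del: of_nat_Suc)
    have "q_deriv (log_component m ?l) =
        fls_const (log_coeff (drop i fs)) * q_deriv (fps_to_fls (reg_primitive (f # take i fs)))"
      using 1 i(1-3) by (simp add: log_component_def q_deriv_const_mult)
    also have "\<dots> = (fls_const (log_coeff (drop i fs)) * fls_const (fps_nth (?l ! i) 0)) *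
          fps_to_fls (reg_primitive (take i ?l)) -
        fps_to_fls f * (fls_const (log_coeff (drop i fs)) * fps_to_fls (reg_primitive (take i fs)))"
      unfolding q_deriv_reg_primitive last butlast by (simp add: right_diff_distrib mult_ac)
    also have "fls_const (log_coeff (drop i fs)) * fps_to_fls (reg_primitive (take i fs)) = log_component m fs"
      using 1 i(1-3) by (simp add: log_component_def)
    also have "(fls_const (log_coeff (drop i fs)) * fls_const (fps_nth (?l ! i) 0)) *
          fps_to_fls (reg_primitive (take i ?l)) = - (of_nat (Suc m) * log_component (Suc m) ?l)"
      unfolding c using 1 i(1-3) by (simp add: log_component_def mult.assoc del: of_nat_Suc)
    finally show ?thesis by simp
  next
    case 2
    then show ?thesis by (simp add: log_component_def q_deriv_def)
  qed (simp add: log_component_def q_deriv_def)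
qed

text \<open>The relation is compared coefficientwise in log q and fed to
  \<open>iterated_primitives_independent\<close>; injectivity of \<open>laurent_of_fract\<close>
  brings the vanishing back to the abstract fractions.\<close>

theorem qlog_expansions_independent:
  fixes a :: "nat list \<Rightarrow> int fps fract"
  assumes S: "finite S" and rel: "(\<Sum>w\<in>S. frac_scale (a w) (qlog_expansion (map eisenstein_rat w))) = 0"
    and w: "w \<in> S"
  shows "a w = 0"
proof -
  define b where "b w = (if w \<in> S then laurent_of_fract (a w) else 0)" for w
  have laurent_K: "laurent_of_fract c \<in> integral_quotients" for c
    using range_laurent_of_fract by blast
  have b: "b w \<in> integral_quotients" for w
    using laurent_K laurent_of_int_fps_in_integral_quotients[of 0] by (simp add: b_def)
  have "b w = 0"
  proof (rule iterated_primitives_independent[where D = q_deriv and g = "\<lambda>k. fps_to_fls (eisenstein_rat k)"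
        and E = "\<lambda>m w. log_component m (map eisenstein_rat w)" and K = integral_quotients])
    fix A c h and k :: nat
    assume A: "finite A" "\<And>k. k \<in> A \<Longrightarrow> c k \<in> integral_quotients \<and> q_deriv (c k) = 0"
      and h: "h \<in> integral_quotients" "(\<Sum>k\<in>A. c k * fps_to_fls (eisenstein_rat k)) = q_deriv h" and "k \<in> A"
    \<comment> \<open>\<open>n * c_n = 0\<close> kills every coefficient except the one at q^0, so
      an element with zero derivative is a rational constant.\<close>
    have c: "c k = fls_const (fls_nth (c k) 0)" if "k \<in> A" for k
    proof (rule fls_eqI)
      fix n
      have "of_int n * fls_nth (c k) n = fls_nth (q_deriv (c k)) n" by simp
      then show "fls_nth (c k) n = fls_nth (fls_const (fls_nth (c k) 0)) n"
        using A(2)[OF that] by (cases "n = 0") auto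
    qed
    have "(\<Sum>k\<in>A. fls_const (fls_nth (c k) 0) * fps_to_fls (eisenstein_rat k)) = q_deriv h"
      unfolding h(2)[symmetric] by (rule sum.cong) (use c in auto)
    from eisenstein_independent_modulo_derivatives[OF A(1) h(1) this] \<open>k \<in> A\<close>
    have "fls_nth (c k) 0 = 0" by blast
    with c[OF \<open>k \<in> A\<close>] show "c k = 0" by simp
  next
    fix m
    have "(\<Sum>w\<in>S. b w * log_component m (map eisenstein_rat w)) = 0"
    proof (rule fls_eqI)
      fix n
      have "fls_nth (\<Sum>w\<in>S. b w * log_component m (map eisenstein_rat w)) n =
          (\<Sum>w\<in>S. coeff (fls_nth (frac_scale (a w) (qlog_expansion (map eisenstein_rat w))) n) m)"
        by (simp add: fls_nth_sum frac_scale_def coeff_scaled_qlog_expansion b_def)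
      also have "\<dots> = coeff (fls_nth (\<Sum>w\<in>S. frac_scale (a w) (qlog_expansion (map eisenstein_rat w))) n) m"
        by (simp add: fls_nth_sum coeff_sum)
      finally show "fls_nth (\<Sum>w\<in>S. b w * log_component m (map eisenstein_rat w)) n = fls_nth 0 n"
        by (simp add: rel)
    qed
    moreover have "(\<Sum>w | b w \<noteq> 0. b w * log_component m (map eisenstein_rat w)) =
        (\<Sum>w\<in>S. b w * log_component m (map eisenstein_rat w))"
      by (rule sum.mono_neutral_left) (use S in \<open>auto simp: b_def\<close>)
    ultimately show "(\<Sum>w | b w \<noteq> 0. b w * log_component m (map eisenstein_rat w)) = 0" by simp
  next
    show "finite {w. b w \<noteq> 0}" by (rule finite_subset[OF _ S]) (auto simp: b_def)
  qed (use b in \<open>auto simp: q_deriv_add q_deriv_mult integral_quotients_diff integral_quotients_mult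
        integral_quotients_divide integral_quotients_q_deriv eisenstein_rat_in_integral_quotients
        log_component_Nil q_deriv_log_component simp del: of_nat_Suc\<close>)
  then have "laurent_of_fract (a w) = 0" using w by (simp add: b_def)
  then show ?thesis
    by (cases "a w") (auto simp: laurent_of_fract_Fract laurent_of_int_fps_hom(4) Zero_fract_def eq_fract)
qed

theorem theorem2p8:
  "\<exists>F :: nat list \<Rightarrow> rat poly fls.
     (\<forall>ks. has_qlog_expansion (iterated_eisenstein ks) (F ks)) \<and>
     inj F \<and> qlog.independent (range F)"
proof (intro exI conjI allI)
  let ?F = "\<lambda>ks. qlog_expansion (map eisenstein_rat ks)"
  show "has_qlog_expansion (iterated_eisenstein ks) (?F ks)" for ks
  proof -
    have eq: "map eisenstein ks = map complex_fps_of_rat (map eisenstein_rat ks)"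
      by (simp add: complex_fps_of_rat_eisenstein)
    show ?thesis
      unfolding iterated_eisenstein_def eq
      by (rule has_qlog_expansion_regularized_integral)
        (auto simp: complex_fps_of_rat_eisenstein eisenstein_conv_radius)
  qed
  \<comment> \<open>Independence of the range concerns a set and would not notice coinciding members
    of the family. Two equal expansions would satisfy the nontrivial relation with coefficients 1
    and -1.\<close>
  show inj: "inj ?F"
  proof (rule injI, rule ccontr)
    fix v w assume eq: "?F v = ?F w" and ne: "v \<noteq> w"
    have "(\<Sum>u\<in>{v, w}. frac_scale (if u = v then 1 else - 1) (?F u)) = 0"
      using ne by (simp add: eq)
    then have "(if v = v then 1 else - 1 :: int fps fract) = 0"
      by (rule qlog_expansions_independent[rotated]) auto
    then show False by simp
  qed
  show "qlog.independent (range ?F)"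
    unfolding qlog.dependent_explicit
  proof safe
    fix t c x assume t: "finite t" "t \<subseteq> range ?F" "(\<Sum>y\<in>t. frac_scale (c y) y) = 0"
      and x: "x \<in> t" "c x \<noteq> 0"
    \<comment> \<open>A relation between elements of the range becomes one between indices;
      injectivity keeps the index set finite and the sum unchanged.\<close>
    define S where "S = ?F -` t"
    have t_eq: "t = ?F ` S" using t(2) by (auto simp: S_def)
    have "finite S" unfolding S_def using t(1) inj by (rule finite_vimageI)
    moreover have "(\<Sum>w\<in>S. frac_scale (c (?F w)) (?F w)) = 0"
      using t(3) unfolding t_eq by (subst (asm) sum.reindex) (auto intro: inj_on_subset[OF inj])
    moreover from x(1) obtain w where "w \<in> S" "x = ?F w" unfolding t_eq by blast
    ultimately show False using qlog_expansions_independent[of S "\<lambda>w. c (?F w)" w] x(2) by blast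
  qed
qed

end
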